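(* Let $\kappa>0$, let $\mathcal U\subset\mathbb R^2$ be an exterior region, and let $L=L_{x_0,\theta}$ be a straight line with $x_0\in\mathbb R^2$, $\theta\in\mathbb S^1$, such that $L\subset\mathcal U$. Let $\Lambda\subset L$ be an arbitrary non-empty open interval of $L$. Then every radiation solution $\psi$ of the Helmholtz equation $\Delta\psi+\kappa^2\psi=0$ in $\mathcal U$ is uniquely determined on $L$ by $\mathrm{Im}(\psi)$ on $\Lambda$. That is, if $\psi_1,\psi_2$ are two radiation solutions in $\mathcal U$ (for the same $\kappa$) with $\mathrm{Im}(\psi_1)=\mathrm{Im}(\psi_2)$ on $\Lambda$, then $\psi_1=\psi_2$ on $L$.
   Context: An exterior region $\mathcal U$ is an open unbounded connected set in $\mathbb R^2$ consisting of all points outside a closed bounded regular curve $S$. A radiation solution in $\mathcal U$ (for fixed $\kappa>0$) is a complex-valued function $\psi$ of class $C^2$ on $\mathcal U$ satisfying $\Delta\psi(x)+\kappa^2\psi(x)=0$ for $x\in\mathcal U$ and the Sommerfeld radiation condition $\sqrt{|x|}\left(\frac{\partial}{\partial|x|}-i\kappa\right)\psi(x)\to0$ as $|x|\to+\infty$, uniformly in $x/|x|$. For $x_0\in\mathbb R^2$ and $\theta\in\mathbb S^1$ (unit circle): $L_{x_0,\theta}=\{x_0+s\theta:\ -\infty<s<+\infty\}$. *)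

theory Defs
  imports "HOL-Analysis.Analysis"
begin

definition partial_deriv :: "'n::finite \<Rightarrow> (real^'n \<Rightarrow> 'b::real_normed_vector) \<Rightarrow> real^'n \<Rightarrow> 'b" where
  "partial_deriv i f x = vector_derivative (\<lambda>t. f (x + t *\<^sub>R axis i 1)) (at 0)"

text \<open>Classes \<open>C\<^sup>1\<close> and \<open>C\<^sup>2\<close> are meant for an open set \<open>U\<close>, where existence and continuity of
  all partial derivatives of the relevant order is the classical definition.  Functions are total
  in HOL; only their values on \<open>U\<close> matter for open \<open>U\<close>.\<close>

definition C1_on :: "(real^'n::finite) set \<Rightarrow> (real^'n \<Rightarrow> 'b::real_normed_vector) \<Rightarrow> bool" where
  "C1_on U f \<longleftrightarrow>
     (\<forall>i. (\<forall>x\<in>U. (\<lambda>t. f (x + t *\<^sub>R axis i 1)) differentiable (at 0)) \<and>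
          continuous_on U (partial_deriv i f))"

definition C2_on :: "(real^'n::finite) set \<Rightarrow> (real^'n \<Rightarrow> 'b::real_normed_vector) \<Rightarrow> bool" where
  "C2_on U f \<longleftrightarrow> C1_on U f \<and> (\<forall>i. C1_on U (partial_deriv i f))"

definition laplacian :: "(real^'n::finite \<Rightarrow> 'b::real_normed_vector) \<Rightarrow> real^'n \<Rightarrow> 'b" where
  "laplacian f x = (\<Sum>i\<in>UNIV. partial_deriv i (partial_deriv i f) x)"

definition regular_arc_on :: "real \<Rightarrow> real \<Rightarrow> (real \<Rightarrow> real^2) \<Rightarrow> bool" where
  "regular_arc_on a b g \<longleftrightarrow>
     (\<exists>g'. continuous_on {a..b} g' \<and>
           (\<forall>t\<in>{a..b}. (g has_vector_derivative g' t) (at t within {a..b}) \<and> g' t \<noteq> 0))"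

text \<open>A closed regular curve is a closed chain of finitely many \<open>C\<^sup>1\<close> arcs with nowhere vanishing
  velocity (one-sided at the endpoints of each arc), so corners are permitted.  A smooth regular
  closed curve is the case of matching one-sided velocities.  Simplicity is not required.
  Boundedness is automatic, the curve being a continuous image of \<open>{0..1}\<close>.\<close>

definition closed_regular_curve :: "(real^2) set \<Rightarrow> bool" where
  "closed_regular_curve S \<longleftrightarrow>
     (\<exists>g (n::nat) (t::nat \<Rightarrow> real).
        t 0 = 0 \<and> t n = 1 \<and>
        (\<forall>k<n. t k < t (Suc k) \<and> regular_arc_on (t k) (t (Suc k)) g) \<and>
        g 0 = g 1 \<and> S = g ` {0..1})"

text \<open>\<open>outside S\<close> is the set of points whose connected component in the complement of \<open>S\<close> is
  unbounded.\<close>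

definition exterior_region :: "(real^2) set \<Rightarrow> bool" where
  "exterior_region U \<longleftrightarrow>
     open U \<and> \<not> bounded U \<and> connected U \<and> (\<exists>S. closed_regular_curve S \<and> U = outside S)"

text \<open>With \<open>x = r *\<^sub>R \<omega>\<close>, \<open>r = |x|\<close> and \<open>\<omega> = x/|x|\<close>, the derivative with respect to \<open>|x|\<close> is the
  derivative in \<open>r\<close> at fixed \<open>\<omega>\<close>, and the limit \<open>r \<rightarrow> \<infinity>\<close> is uniform in \<open>\<omega>\<close> on the unit circle.\<close>

definition sommerfeld_radiation :: "real \<Rightarrow> (real^2 \<Rightarrow> complex) \<Rightarrow> bool" where
  "sommerfeld_radiation \<kappa> \<psi> \<longleftrightarrow>
     uniform_limit (sphere 0 1)
       (\<lambda>r \<omega>. of_real (sqrt r) *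
          (vector_derivative (\<lambda>s. \<psi> (s *\<^sub>R \<omega>)) (at r) - \<i> * of_real \<kappa> * \<psi> (r *\<^sub>R \<omega>)))
       (\<lambda>\<omega>. 0) at_top"

definition radiation_solution :: "real \<Rightarrow> (real^2) set \<Rightarrow> (real^2 \<Rightarrow> complex) \<Rightarrow> bool" where
  "radiation_solution \<kappa> U \<psi> \<longleftrightarrow>
     C2_on U \<psi> \<and>
     (\<forall>x\<in>U. laplacian \<psi> x + of_real (\<kappa>\<^sup>2) * \<psi> x = 0) \<and>
     sommerfeld_radiation \<kappa> \<psi>"

definition straight_line :: "real^2 \<Rightarrow> real^2 \<Rightarrow> (real^2) set" where
  "straight_line x\<^sub>0 \<theta> = {x\<^sub>0 + s *\<^sub>R \<theta> | s. True}"

text \<open>Non-empty open intervals of a line are the images of the non-empty open real intervals, bounded or not,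
  under its parametrization.\<close>

definition nonempty_open_interval_of_line :: "real^2 \<Rightarrow> real^2 \<Rightarrow> (real^2) set \<Rightarrow> bool" where
  "nonempty_open_interval_of_line x\<^sub>0 \<theta> \<Lambda> \<longleftrightarrow>
     (\<exists>J. open J \<and> is_interval J \<and> J \<noteq> {} \<and> \<Lambda> = {x\<^sub>0 + s *\<^sub>R \<theta> | s. s \<in> J})"

end

theory Submission
  imports Defs "HOL-Complex_Analysis.Complex_Analysis"
begin

text \<open>Identify the plane with the complex numbers so that the line is \<open>Im z = b\<close>, and let \<open>u\<close> be the difference of the
  two solutions.  A solution of the Helmholtz equation extends holomorphically along a line (the equation
  becomes the Klein--Gordon equation on complexified lines), so \<open>Im u\<close> vanishes on the whole line and,
  by uniqueness in the Cauchy problem, is odd about it outside a large disc.  Inserting this symmetry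
  in the radiation condition shows that the even part of \<open>Re u\<close> has angular modes of order \<open>o(1/sqrt r)\<close>.
  These modes solve the Bessel equation, so they vanish (Rellich).  Hence \<open>u\<close> vanishes on the line far away, and
  everywhere on the line by analyticity.\<close>

section \<open>Helmholtz functions in the complex plane\<close>

text \<open>The radiation condition couples the two real parts of \<open>u\<close>: its imaginary
  part says that the radial derivative of \<open>Im u\<close> equals \<kappa> times
  \<open>Re u\<close> up to o(1/sqrt r), so a symmetry of \<open>Im u\<close> far away passes to
  \<open>Re u\<close> up to o(1/sqrt r). No nonzero real solution of Bessel's equation decays at
  that rate, so neither a far-field expansion nor a Green representation enters. Two obstacles shape
  the proof. The domain and its mirror image may meet in a disconnected set, so uniqueness is
  derived along single straight lines contained in the domain, from an explicit extension formula.
  And the radiation condition is centred at the origin while the line lies at height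
  \<open>b\<close>: rotations preserve the condition exactly, translations only asymptotically, so
  the line is rotated but \<open>b\<close> is kept. Reflection then leaves a tangential derivative
  with weight \<open>b\<close>, which radiation does not control; tested against an angular mode, it
  can be integrated by parts.\<close>

definition has_grad ::
    "complex set \<Rightarrow> (complex \<Rightarrow> 'a::real_normed_vector) \<Rightarrow> (complex \<Rightarrow> 'a) \<Rightarrow> (complex \<Rightarrow> 'a) \<Rightarrow> bool" where
  "has_grad D u p q \<longleftrightarrow>
     (\<forall>z\<in>D. (u has_derivative (\<lambda>h. Re h *\<^sub>R p z + Im h *\<^sub>R q z)) (at z))"

text \<open>First partials are arguments because the radiation condition and the Cauchy data refer
  to them. \<open>pq\<close> and \<open>qp\<close> are kept apart, so that no symmetry of mixed
  derivatives has to be shown. The real scalar multiple lets the notion apply to \<open>u\<close>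
  and to its real and imaginary parts alike.\<close>

definition helmholtz_on :: "real \<Rightarrow> complex set \<Rightarrow> (complex \<Rightarrow> 'a::real_normed_vector) \<Rightarrow>
    (complex \<Rightarrow> 'a) \<Rightarrow> (complex \<Rightarrow> 'a) \<Rightarrow> bool" where
  "helmholtz_on \<kappa> D u p q \<longleftrightarrow> open D \<and> has_grad D u p q \<and>
     (\<exists>pp pq qp qq. has_grad D p pp pq \<and> has_grad D q qp qq \<and>
        continuous_on D pp \<and> continuous_on D pq \<and> continuous_on D qp \<and> continuous_on D qq \<and>
        (\<forall>z\<in>D. pp z + qq z + \<kappa>\<^sup>2 *\<^sub>R u z = 0))"

lemma helmholtz_onI:
  assumes "open D" "has_grad D u p q" "has_grad D p pp pq" "has_grad D q qp qq"
    "continuous_on D pp" "continuous_on D pq" "continuous_on D qp" "continuous_on D qq"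
    "\<And>z. z \<in> D \<Longrightarrow> pp z + qq z + \<kappa>\<^sup>2 *\<^sub>R u z = 0"
  shows "helmholtz_on \<kappa> D u p q"
  unfolding helmholtz_on_def using assms by blast

section \<open>Stability under restriction, sums and linear images\<close>

lemma has_grad_continuous_on:
  assumes "has_grad D u p q"
  shows "continuous_on D u"
  using assms unfolding has_grad_def
  by (meson continuous_at_imp_continuous_on has_derivative_continuous)

lemma has_grad_subset: "has_grad D u p q \<Longrightarrow> E \<subseteq> D \<Longrightarrow> has_grad E u p q"
  unfolding has_grad_def by blast

lemma helmholtz_on_subset:
  "helmholtz_on \<kappa> D u p q \<Longrightarrow> E \<subseteq> D \<Longrightarrow> open E \<Longrightarrow> helmholtz_on \<kappa> E u p q"
  unfolding helmholtz_on_def by (meson has_grad_subset continuous_on_subset subsetD)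

lemma has_grad_add:
  assumes "has_grad D u p q" "has_grad D v r s"
  shows "has_grad D (\<lambda>z. u z + v z) (\<lambda>z. p z + r z) (\<lambda>z. q z + s z)"
  unfolding has_grad_def
proof
  fix z assume "z \<in> D"
  then have "(u has_derivative (\<lambda>h. Re h *\<^sub>R p z + Im h *\<^sub>R q z)) (at z)"
    "(v has_derivative (\<lambda>h. Re h *\<^sub>R r z + Im h *\<^sub>R s z)) (at z)"
    using assms unfolding has_grad_def by auto
  from has_derivative_add[OF this]
  show "((\<lambda>z. u z + v z) has_derivative (\<lambda>h. Re h *\<^sub>R (p z + r z) + Im h *\<^sub>R (q z + s z))) (at z)"
    by (simp add: algebra_simps)
qed

lemma helmholtz_on_add:
  assumes "helmholtz_on \<kappa> D u p q" "helmholtz_on \<kappa> D v r s"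
  shows "helmholtz_on \<kappa> D (\<lambda>z. u z + v z) (\<lambda>z. p z + r z) (\<lambda>z. q z + s z)"
proof -
  from assms obtain pp pq qp qq rr rs sr ss where
    *: "has_grad D p pp pq" "has_grad D q qp qq" "continuous_on D pp" "continuous_on D pq"
      "continuous_on D qp" "continuous_on D qq" "\<forall>z\<in>D. pp z + qq z + \<kappa>\<^sup>2 *\<^sub>R u z = 0"
      "has_grad D r rr rs" "has_grad D s sr ss" "continuous_on D rr" "continuous_on D rs"
      "continuous_on D sr" "continuous_on D ss" "\<forall>z\<in>D. rr z + ss z + \<kappa>\<^sup>2 *\<^sub>R v z = 0"
    unfolding helmholtz_on_def by blast
  have "\<forall>z\<in>D. (pp z + rr z) + (qq z + ss z) + \<kappa>\<^sup>2 *\<^sub>R (u z + v z) = 0"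
  proof
    fix z assume "z \<in> D"
    then have "(pp z + qq z + \<kappa>\<^sup>2 *\<^sub>R u z) + (rr z + ss z + \<kappa>\<^sup>2 *\<^sub>R v z) = 0"
      using * by auto
    then show "(pp z + rr z) + (qq z + ss z) + \<kappa>\<^sup>2 *\<^sub>R (u z + v z) = 0"
      by (simp add: algebra_simps)
  qed
  moreover have "open D" "has_grad D u p q" "has_grad D v r s"
    using assms unfolding helmholtz_on_def by auto
  ultimately show ?thesis
    by (intro helmholtz_onI[OF _ _ has_grad_add[OF *(1) *(8)] has_grad_add[OF *(2) *(9)]]
        has_grad_add continuous_on_add *) auto
qed

lemma has_grad_bounded_linear:
  assumes "bounded_linear T" "has_grad D u p q"
  shows "has_grad D (\<lambda>z. T (u z)) (\<lambda>z. T (p z)) (\<lambda>z. T (q z))"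
  unfolding has_grad_def
proof
  fix z assume "z \<in> D"
  then have "(u has_derivative (\<lambda>h. Re h *\<^sub>R p z + Im h *\<^sub>R q z)) (at z)"
    using assms unfolding has_grad_def by auto
  from bounded_linear.has_derivative[OF assms(1) this]
  show "((\<lambda>z. T (u z)) has_derivative (\<lambda>h. Re h *\<^sub>R T (p z) + Im h *\<^sub>R T (q z))) (at z)"
    by (simp add: linear_add[OF bounded_linear.linear[OF assms(1)]]
        linear_scale[OF bounded_linear.linear[OF assms(1)]])
qed

lemma helmholtz_on_bounded_linear:
  assumes T: "bounded_linear T" and u: "helmholtz_on \<kappa> D u p q"
  shows "helmholtz_on \<kappa> D (\<lambda>z. T (u z)) (\<lambda>z. T (p z)) (\<lambda>z. T (q z))"
proof -
  from u obtain pp pq qp qq where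
    *: "has_grad D p pp pq" "has_grad D q qp qq" "continuous_on D pp" "continuous_on D pq"
      "continuous_on D qp" "continuous_on D qq" "\<forall>z\<in>D. pp z + qq z + \<kappa>\<^sup>2 *\<^sub>R u z = 0"
    unfolding helmholtz_on_def by blast
  have lin: "linear T" using T by (rule bounded_linear.linear)
  have "\<forall>z\<in>D. T (pp z) + T (qq z) + \<kappa>\<^sup>2 *\<^sub>R T (u z) = 0"
    using *(7) by (metis lin linear_add linear_scale linear_0)
  moreover have "open D" "has_grad D u p q"
    using u unfolding helmholtz_on_def by auto
  ultimately show ?thesis
    by (intro helmholtz_onI[OF _ _ has_grad_bounded_linear[OF T *(1)] has_grad_bounded_linear[OF T *(2)]]
        has_grad_bounded_linear[OF T] bounded_linear.continuous_on[OF T] *) auto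
qed

section \<open>Rigid motions and complex conjugation\<close>

lemma has_grad_rigid:
  assumes "has_grad D u p q"
  shows "has_grad {z. a + \<theta> * z \<in> D} (\<lambda>z. u (a + \<theta> * z))
    (\<lambda>z. Re \<theta> *\<^sub>R p (a + \<theta> * z) + Im \<theta> *\<^sub>R q (a + \<theta> * z))
    (\<lambda>z. (- Im \<theta>) *\<^sub>R p (a + \<theta> * z) + Re \<theta> *\<^sub>R q (a + \<theta> * z))"
  unfolding has_grad_def
proof
  fix z assume "z \<in> {z. a + \<theta> * z \<in> D}"
  then have u: "(u has_derivative (\<lambda>h. Re h *\<^sub>R p (a + \<theta> * z) + Im h *\<^sub>R q (a + \<theta> * z))) (at (a + \<theta> * z))"
    using assms unfolding has_grad_def by auto
  have "((\<lambda>z. a + \<theta> * z) has_derivative (\<lambda>h. \<theta> * h)) (at z)"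
    by (auto intro!: derivative_eq_intros)
  from has_derivative_compose[OF this u]
  show "((\<lambda>z. u (a + \<theta> * z)) has_derivative
    (\<lambda>h. Re h *\<^sub>R (Re \<theta> *\<^sub>R p (a + \<theta> * z) + Im \<theta> *\<^sub>R q (a + \<theta> * z)) +
         Im h *\<^sub>R ((- Im \<theta>) *\<^sub>R p (a + \<theta> * z) + Re \<theta> *\<^sub>R q (a + \<theta> * z)))) (at z)"
    by (simp add: algebra_simps)
qed

lemma has_grad_lincomb:
  fixes \<alpha> \<beta> :: real
  assumes "has_grad D u p q" "has_grad D v r s"
  shows "has_grad D (\<lambda>z. \<alpha> *\<^sub>R u z + \<beta> *\<^sub>R v z) (\<lambda>z. \<alpha> *\<^sub>R p z + \<beta> *\<^sub>R r z) (\<lambda>z. \<alpha> *\<^sub>R q z + \<beta> *\<^sub>R s z)"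
  by (intro has_grad_add has_grad_bounded_linear[OF bounded_linear_scaleR_right[of \<alpha>] assms(1)]
      has_grad_bounded_linear[OF bounded_linear_scaleR_right[of \<beta>] assms(2)])

text \<open>In the rotated Laplacian the mixed derivatives cancel in pairs, and
  \<open>cmod \<theta> = 1\<close> turns the coefficients of \<open>pp\<close> and \<open>qq\<close>
  into 1. This moves any line to the real axis, where the extension formula is available.\<close>

lemma helmholtz_on_rigid:
  assumes u: "helmholtz_on \<kappa> D u p q" and \<theta>: "cmod \<theta> = 1"
  shows "helmholtz_on \<kappa> {z. a + \<theta> * z \<in> D} (\<lambda>z. u (a + \<theta> * z))
    (\<lambda>z. Re \<theta> *\<^sub>R p (a + \<theta> * z) + Im \<theta> *\<^sub>R q (a + \<theta> * z))
    (\<lambda>z. (- Im \<theta>) *\<^sub>R p (a + \<theta> * z) + Re \<theta> *\<^sub>R q (a + \<theta> * z))"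
proof -
  from u obtain pp pq qp qq where
    *: "has_grad D p pp pq" "has_grad D q qp qq" "continuous_on D pp" "continuous_on D pq"
      "continuous_on D qp" "continuous_on D qq" "\<forall>z\<in>D. pp z + qq z + \<kappa>\<^sup>2 *\<^sub>R u z = 0"
    and D: "open D" "has_grad D u p q"
    unfolding helmholtz_on_def by blast
  have cont: "continuous_on {z. a + \<theta> * z \<in> D} (\<lambda>z. f (a + \<theta> * z))"
    if "continuous_on D f" for f :: "complex \<Rightarrow> 'a"
    by (rule continuous_on_compose2[OF that]) (auto intro!: continuous_intros)
  have sq: "Re \<theta> * Re \<theta> + Im \<theta> * Im \<theta> = 1"
    using \<theta> by (simp add: cmod_def power2_eq_square)
  let ?c = "Re \<theta>" and ?s = "Im \<theta>"
  let ?pp = "\<lambda>z. ?c *\<^sub>R (?c *\<^sub>R pp (a + \<theta> * z) + ?s *\<^sub>R pq (a + \<theta> * z)) +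
                 ?s *\<^sub>R (?c *\<^sub>R qp (a + \<theta> * z) + ?s *\<^sub>R qq (a + \<theta> * z))"
  let ?pq = "\<lambda>z. ?c *\<^sub>R ((- ?s) *\<^sub>R pp (a + \<theta> * z) + ?c *\<^sub>R pq (a + \<theta> * z)) +
                 ?s *\<^sub>R ((- ?s) *\<^sub>R qp (a + \<theta> * z) + ?c *\<^sub>R qq (a + \<theta> * z))"
  let ?qp = "\<lambda>z. (- ?s) *\<^sub>R (?c *\<^sub>R pp (a + \<theta> * z) + ?s *\<^sub>R pq (a + \<theta> * z)) +
                 ?c *\<^sub>R (?c *\<^sub>R qp (a + \<theta> * z) + ?s *\<^sub>R qq (a + \<theta> * z))"
  let ?qq = "\<lambda>z. (- ?s) *\<^sub>R ((- ?s) *\<^sub>R pp (a + \<theta> * z) + ?c *\<^sub>R pq (a + \<theta> * z)) +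
                 ?c *\<^sub>R ((- ?s) *\<^sub>R qp (a + \<theta> * z) + ?c *\<^sub>R qq (a + \<theta> * z))"
  have "\<forall>z\<in>{z. a + \<theta> * z \<in> D}. ?pp z + ?qq z + \<kappa>\<^sup>2 *\<^sub>R u (a + \<theta> * z) = 0"
  proof
    fix z assume z: "z \<in> {z. a + \<theta> * z \<in> D}"
    let ?w = "a + \<theta> * z"
    have "?pp z + ?qq z = (?c * ?c + ?s * ?s) *\<^sub>R pp ?w + (?c * ?c + ?s * ?s) *\<^sub>R qq ?w"
      by (simp add: algebra_simps)
    then show "?pp z + ?qq z + \<kappa>\<^sup>2 *\<^sub>R u (a + \<theta> * z) = 0"
      using * z sq by simp
  qed
  moreover have "open {z. a + \<theta> * z \<in> D}"
    using open_vimage[OF D(1), of "\<lambda>z. a + \<theta> * z"] continuous_on_add[OF continuous_on_const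
      continuous_on_mult[OF continuous_on_const continuous_on_id], of UNIV a \<theta>]
    by (simp add: vimage_def)
  moreover have "has_grad {z. a + \<theta> * z \<in> D} (\<lambda>z. Re \<theta> *\<^sub>R p (a + \<theta> * z) + Im \<theta> *\<^sub>R q (a + \<theta> * z)) ?pp ?pq"
    by (rule has_grad_lincomb[OF has_grad_rigid[OF *(1)] has_grad_rigid[OF *(2)]])
  moreover have "has_grad {z. a + \<theta> * z \<in> D} (\<lambda>z. (- Im \<theta>) *\<^sub>R p (a + \<theta> * z) + Re \<theta> *\<^sub>R q (a + \<theta> * z)) ?qp ?qq"
    by (rule has_grad_lincomb[OF has_grad_rigid[OF *(1)] has_grad_rigid[OF *(2)]])
  moreover have "continuous_on {z. a + \<theta> * z \<in> D} ?pp" "continuous_on {z. a + \<theta> * z \<in> D} ?pq"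
    "continuous_on {z. a + \<theta> * z \<in> D} ?qp" "continuous_on {z. a + \<theta> * z \<in> D} ?qq"
    by (intro continuous_intros cont *)+
  ultimately show ?thesis
    by (intro helmholtz_onI[where pp="?pp" and pq="?pq" and qp="?qp" and qq="?qq"] has_grad_rigid[OF D(2)]) blast+
qed

lemma has_grad_cnj:
  assumes "has_grad D u p q"
  shows "has_grad {z. cnj z \<in> D} (\<lambda>z. u (cnj z)) (\<lambda>z. p (cnj z)) (\<lambda>z. - q (cnj z))"
  unfolding has_grad_def
proof
  fix z assume "z \<in> {z. cnj z \<in> D}"
  then have u: "(u has_derivative (\<lambda>h. Re h *\<^sub>R p (cnj z) + Im h *\<^sub>R q (cnj z))) (at (cnj z))"
    using assms unfolding has_grad_def by auto
  have "(cnj has_derivative cnj) (at z)"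
    by (rule bounded_linear_imp_has_derivative) (rule bounded_linear_cnj)
  from has_derivative_compose[OF this u]
  show "((\<lambda>z. u (cnj z)) has_derivative (\<lambda>h. Re h *\<^sub>R p (cnj z) + Im h *\<^sub>R - q (cnj z))) (at z)"
    by simp
qed

lemma helmholtz_on_cnj:
  assumes u: "helmholtz_on \<kappa> D u p q"
  shows "helmholtz_on \<kappa> {z. cnj z \<in> D} (\<lambda>z. u (cnj z)) (\<lambda>z. p (cnj z)) (\<lambda>z. - q (cnj z))"
proof -
  from u obtain pp pq qp qq where
    *: "has_grad D p pp pq" "has_grad D q qp qq" "continuous_on D pp" "continuous_on D pq"
      "continuous_on D qp" "continuous_on D qq" "\<forall>z\<in>D. pp z + qq z + \<kappa>\<^sup>2 *\<^sub>R u z = 0"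
    and D: "open D" "has_grad D u p q"
    unfolding helmholtz_on_def by blast
  have cont: "continuous_on {z. cnj z \<in> D} (\<lambda>z. f (cnj z))"
    if "continuous_on D f" for f :: "complex \<Rightarrow> 'a"
    by (rule continuous_on_compose2[OF that]) (auto intro!: continuous_intros)
  have "open {z. cnj z \<in> D}"
    using open_vimage[OF D(1), of cnj] by (auto intro!: continuous_intros simp: vimage_def)
  moreover have "has_grad {z. cnj z \<in> D} (\<lambda>z. - q (cnj z)) (\<lambda>z. - qp (cnj z)) (\<lambda>z. qq (cnj z))"
    using has_grad_bounded_linear[OF bounded_linear_minus[OF bounded_linear_ident] has_grad_cnj[OF *(2)]] by simp
  moreover have "continuous_on {z. cnj z \<in> D} (\<lambda>z. pp (cnj z))" "continuous_on {z. cnj z \<in> D} (\<lambda>z. - pq (cnj z))"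
    "continuous_on {z. cnj z \<in> D} (\<lambda>z. - qp (cnj z))" "continuous_on {z. cnj z \<in> D} (\<lambda>z. qq (cnj z))"
    by (intro continuous_intros cont *)+
  ultimately show ?thesis
    using *(7) by (intro helmholtz_onI[OF _ has_grad_cnj[OF D(2)] has_grad_cnj[OF *(1)],
        where qp="\<lambda>z. - qp (cnj z)" and qq="\<lambda>z. qq (cnj z)"]) simp_all
qed

text \<open>The bridge from the classical definition of class C1, by partial derivatives, to the
  Frechet derivatives on which all later chain rules rest.\<close>

lemma has_grad_partials:
  fixes f :: "complex \<Rightarrow> 'a::real_normed_vector"
  assumes D: "open D"
    and fx: "\<And>z. z \<in> D \<Longrightarrow> ((\<lambda>t. f (z + of_real t)) has_vector_derivative p z) (at 0)"
    and fy: "\<And>z. z \<in> D \<Longrightarrow> ((\<lambda>t. f (z + \<i> * of_real t)) has_vector_derivative q z) (at 0)"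
    and q: "continuous_on D q"
  shows "has_grad D f p q"
  unfolding has_grad_def
proof
  fix z assume z: "z \<in> D"
  have "open {w::real \<times> real. Complex (fst w) (snd w) \<in> D}"
  proof -
    have "continuous_on UNIV (\<lambda>w::real \<times> real. Complex (fst w) (snd w))"
      by (auto intro!: continuous_intros simp: Complex_eq)
    from open_vimage[OF D this] show ?thesis by (simp add: vimage_def)
  qed
  moreover have "(Re z, Im z) \<in> {w::real \<times> real. Complex (fst w) (snd w) \<in> D}" using z by simp
  ultimately obtain X Y where XY: "open X" "open Y" "Re z \<in> X" "Im z \<in> Y"
    "X \<times> Y \<subseteq> {w. Complex (fst w) (snd w) \<in> D}"
    by (auto elim!: open_prod_elim)
  \<comment> \<open>The criterion for partial derivatives wants a convex second factor, hence the
    shrinking of \<open>Y\<close> to a ball.\<close>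
  from \<open>open Y\<close> \<open>Im z \<in> Y\<close> obtain r where r: "r > 0" "ball (Im z) r \<subseteq> Y"
    by (meson openE)
  let ?Y = "ball (Im z) r"
  have sub: "Complex x y \<in> D" if "x \<in> X" "y \<in> ?Y" for x y
  proof -
    from that r have "(x, y) \<in> X \<times> Y" by blast
    with XY(5) have "(x, y) \<in> {w. Complex (fst w) (snd w) \<in> D}" by (rule subsetD)
    then show ?thesis by simp
  qed
  have fx': "((\<lambda>x. f (Complex x y)) has_vector_derivative p (Complex x y)) (at x)" if "Complex x y \<in> D" for x y
  proof -
    have "((\<lambda>t. f (Complex x y + of_real t)) has_vector_derivative p (Complex x y)) (at (x - x))"
      using fx[OF that] by simp
    moreover have "(\<lambda>t. f (Complex x y + of_real t)) = (\<lambda>t. f (Complex (x + t) y))"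
      by (intro ext arg_cong[where f=f]) (simp add: complex_eq_iff)
    ultimately have "((\<lambda>t. f (Complex (x + t) y)) has_vector_derivative p (Complex x y)) (at (x - x))"
      by simp
    moreover have "((\<lambda>t. t - x) has_vector_derivative 1) (at x)" by (auto intro!: derivative_eq_intros)
    ultimately have "((\<lambda>t. f (Complex (x + t) y)) \<circ> (\<lambda>t. t - x) has_vector_derivative 1 *\<^sub>R p (Complex x y)) (at x)"
      by (intro vector_diff_chain_at)
    then show ?thesis by (simp add: o_def)
  qed
  have fy': "((\<lambda>y. f (Complex x y)) has_vector_derivative q (Complex x y)) (at y)" if "Complex x y \<in> D" for x y
  proof -
    have "((\<lambda>t. f (Complex x y + \<i> * of_real t)) has_vector_derivative q (Complex x y)) (at (y - y))"
      using fy[OF that] by simp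
    moreover have "(\<lambda>t. f (Complex x y + \<i> * of_real t)) = (\<lambda>t. f (Complex x (y + t)))"
      by (intro ext arg_cong[where f=f]) (simp add: complex_eq_iff)
    ultimately have "((\<lambda>t. f (Complex x (y + t))) has_vector_derivative q (Complex x y)) (at (y - y))"
      by simp
    moreover have "((\<lambda>t. t - y) has_vector_derivative 1) (at y)" by (auto intro!: derivative_eq_intros)
    ultimately have "((\<lambda>t. f (Complex x (y + t))) \<circ> (\<lambda>t. t - y) has_vector_derivative 1 *\<^sub>R q (Complex x y)) (at y)"
      by (intro vector_diff_chain_at)
    then show ?thesis by (simp add: o_def)
  qed
  have "((\<lambda>(x, y). f (Complex x y)) has_derivative
      (\<lambda>(tx, ty). tx *\<^sub>R p z + blinfun_apply (blinfun_scaleR_left (q (Complex (Re z) (Im z)))) ty))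
      (at (Re z, Im z) within X \<times> ?Y)"
  proof (rule has_derivative_partialsI)
    show "((\<lambda>x. f (Complex x (Im z))) has_derivative (\<lambda>tx. tx *\<^sub>R p z)) (at (Re z) within X)"
      using fx'[of "Re z" "Im z"] z unfolding has_vector_derivative_def
      by (auto intro: has_derivative_at_withinI)
    show "((\<lambda>y. f (Complex x y)) has_derivative blinfun_apply (blinfun_scaleR_left (q (Complex x y)))) (at y within ?Y)"
      if "x \<in> X" "y \<in> ?Y" for x y
      using fy'[OF sub[OF that]] unfolding has_vector_derivative_def
      by (auto intro: has_derivative_at_withinI)
    have "isCont q z" using q D z continuous_on_eq_continuous_at by blast
    then have "continuous (at (Re z, Im z)) (\<lambda>w. q (Complex (fst w) (snd w)))"
    proof -
      have "isCont (\<lambda>w. Complex (fst w) (snd w)) (Re z, Im z)"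
        by (auto intro!: continuous_intros simp: Complex_eq)
      moreover have "isCont q (Complex (fst (Re z, Im z)) (snd (Re z, Im z)))"
        using \<open>isCont q z\<close> by simp
      ultimately show ?thesis by (rule isCont_o2)
    qed
    then have "continuous (at (Re z, Im z) within X \<times> ?Y) (\<lambda>w. blinfun_scaleR_left (q (Complex (fst w) (snd w))))"
      by (rule bounded_linear.continuous[OF bounded_linear_blinfun_scaleR_left continuous_at_imp_continuous_within])
    then show "continuous (at (Re z, Im z) within X \<times> ?Y) (\<lambda>(x, y). blinfun_scaleR_left (q (Complex x y)))"
      by (simp add: case_prod_unfold)
  qed (use r in auto)
  then have "((\<lambda>(x, y). f (Complex x y)) has_derivative (\<lambda>(tx, ty). tx *\<^sub>R p z + ty *\<^sub>R q z)) (at (Re z, Im z))"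
    using XY r by (simp add: at_within_open[of _ "X \<times> ?Y"] open_Times)
  moreover have "((\<lambda>z. (Re z, Im z)) has_derivative (\<lambda>h. (Re h, Im h))) (at z)"
    by (auto intro!: derivative_eq_intros)
  ultimately have "((\<lambda>z. (\<lambda>(x, y). f (Complex x y)) (Re z, Im z)) has_derivative
      (\<lambda>h. (\<lambda>(tx, ty). tx *\<^sub>R p z + ty *\<^sub>R q z) (Re h, Im h))) (at z)"
    by (rule has_derivative_compose[rotated])
  then show "(f has_derivative (\<lambda>h. Re h *\<^sub>R p z + Im h *\<^sub>R q z)) (at z)"
    by simp
qed

lemma has_grad_imp_holomorphic:
  assumes "open D" "has_grad D F p q" "\<And>z. z \<in> D \<Longrightarrow> q z = \<i> * p z"
  shows "F holomorphic_on D"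
proof -
  have "(F has_field_derivative p z) (at z)" if "z \<in> D" for z
  proof -
    have "(\<lambda>h. Re h *\<^sub>R p z + Im h *\<^sub>R q z) = (*) (p z)"
      using assms(3)[OF that] by (auto simp: complex_eq_iff algebra_simps)
    then show ?thesis using assms(2) that
      unfolding has_grad_def has_field_derivative_def by auto
  qed
  then show ?thesis using assms(1)
    using holomorphic_on_open by blast
qed

section \<open>Holomorphic extension along lines\<close>

lemma has_grad_integral:
  fixes h :: "complex \<Rightarrow> real \<Rightarrow> 'a::banach"
  assumes D: "open D"
    and h: "\<And>s. s \<in> {a..b} \<Longrightarrow> has_grad D (\<lambda>z. h z s) (\<lambda>z. p z s) (\<lambda>z. q z s)"
    and ch: "continuous_on (D \<times> {a..b}) (\<lambda>(z, s). h z s)"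
    and cp: "continuous_on (D \<times> {a..b}) (\<lambda>(z, s). p z s)"
    and cq: "continuous_on (D \<times> {a..b}) (\<lambda>(z, s). q z s)"
  shows "has_grad D (\<lambda>z. integral {a..b} (h z)) (\<lambda>z. integral {a..b} (p z)) (\<lambda>z. integral {a..b} (q z))"
  unfolding has_grad_def
proof
  fix z assume z: "z \<in> D"
  with D obtain r where r: "r > 0" "ball z r \<subseteq> D" by (meson openE)
  \<comment> \<open>The Leibniz rule expects the derivative as an operator-valued integrand;
    \<open>G\<close> packs the two partials into one bounded linear map, and the integral is
    unpacked again at the end.\<close>
  define G :: "complex \<Rightarrow> real \<Rightarrow> complex \<Rightarrow>\<^sub>L 'a" where
    "G w s = (blinfun_scaleR_left (p w s) o\<^sub>L Blinfun Re) + (blinfun_scaleR_left (q w s) o\<^sub>L Blinfun Im)" for w s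
  have G: "blinfun_apply (G w s) k = Re k *\<^sub>R p w s + Im k *\<^sub>R q w s" for w s k
    by (simp add: G_def blinfun.add_left bounded_linear_Blinfun_apply bounded_linear_Re bounded_linear_Im)
  have slice: "continuous_on {a..b} (f w)"
    if "continuous_on (D \<times> {a..b}) (\<lambda>(z, s). f z s)" "w \<in> D" for f :: "complex \<Rightarrow> real \<Rightarrow> 'a" and w
  proof -
    have "continuous_on {a..b} ((\<lambda>(z, s). f z s) \<circ> (\<lambda>s. (w, s)))"
      by (rule continuous_on_compose)
        (auto intro!: continuous_intros continuous_on_subset[OF that(1)] simp: that(2))
    then show ?thesis by (simp add: o_def)
  qed
  have int: "f w integrable_on {a..b}"
    if "continuous_on (D \<times> {a..b}) (\<lambda>(z, s). f z s)" "w \<in> D" for f :: "complex \<Rightarrow> real \<Rightarrow> 'a" and w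
    using slice[OF that] by (rule integrable_continuous_real)
  have cG: "continuous_on (D \<times> {a..b}) (\<lambda>(w, s). G w s)"
  proof -
    have "continuous_on (D \<times> {a..b}) (\<lambda>x. blinfun_scaleR_left (p (fst x) (snd x)))"
      using cp by (intro bounded_linear.continuous_on[OF bounded_linear_blinfun_scaleR_left])
        (simp add: case_prod_unfold)
    moreover have "continuous_on (D \<times> {a..b}) (\<lambda>x. blinfun_scaleR_left (q (fst x) (snd x)))"
      using cq by (intro bounded_linear.continuous_on[OF bounded_linear_blinfun_scaleR_left])
        (simp add: case_prod_unfold)
    ultimately show ?thesis
      unfolding G_def case_prod_unfold
      by (intro continuous_on_add[OF bounded_bilinear.continuous_on[OF bounded_bilinear_blinfun_compose _ continuous_on_const]
        bounded_bilinear.continuous_on[OF bounded_bilinear_blinfun_compose _ continuous_on_const]])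
  qed
  have "((\<lambda>w. integral (cbox a b) (h w)) has_derivative integral (cbox a b) (G z)) (at z within ball z r)"
  proof (rule leibniz_rule)
    show "((\<lambda>w. h w s) has_derivative blinfun_apply (G w s)) (at w within ball z r)"
      if "w \<in> ball z r" "s \<in> cbox a b" for w s
    proof -
      have "blinfun_apply (G w s) = (\<lambda>k. Re k *\<^sub>R p w s + Im k *\<^sub>R q w s)"
        by (rule ext) (rule G)
      moreover have "w \<in> D" "s \<in> {a..b}" using that r(2) by auto
      ultimately show ?thesis
        using h[of s] unfolding has_grad_def by (metis has_derivative_at_withinI)
    qed
    show "h w integrable_on cbox a b" if "w \<in> ball z r" for w
      using int[OF ch] that r by auto
    show "continuous_on (ball z r \<times> cbox a b) (\<lambda>(w, s). G w s)"
      using r by (intro continuous_on_subset[OF cG]) auto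
  qed (use r in auto)
  then have "((\<lambda>w. integral {a..b} (h w)) has_derivative integral {a..b} (G z)) (at z)"
    using r by (simp add: at_within_open[of z "ball z r"])
  moreover have "blinfun_apply (integral {a..b} (G z)) =
      (\<lambda>k. Re k *\<^sub>R integral {a..b} (p z) + Im k *\<^sub>R integral {a..b} (q z))"
  proof
    fix k
    have "continuous_on {a..b} ((\<lambda>(w, s). G w s) \<circ> (\<lambda>s. (z, s)))"
      by (rule continuous_on_compose)
        (auto intro!: continuous_intros continuous_on_subset[OF cG] simp: z)
    then have "G z integrable_on {a..b}"
      by (intro integrable_continuous_real) (simp add: o_def)
    from blinfun_apply_integral[OF this, of k]
    show "blinfun_apply (integral {a..b} (G z)) k =
        Re k *\<^sub>R integral {a..b} (p z) + Im k *\<^sub>R integral {a..b} (q z)"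
      using int[OF cp z] int[OF cq z] by (simp add: G integral_add integrable_cmul)
  qed
  ultimately show "((\<lambda>w. integral {a..b} (h w)) has_derivative
      (\<lambda>k. Re k *\<^sub>R integral {a..b} (p z) + Im k *\<^sub>R integral {a..b} (q z))) (at z)"
    by (simp only:)
qed

text \<open>The function is I_0(2 sqrt(m x)), with I_0 the modified Bessel function of order 0.
  Taking the variable under the root as argument gives an entire power series, with coefficients
  m^n/(n!)^2, and avoids the singularity of the root at 0.\<close>

lemma modified_bessel_exists:
  fixes m :: real
  obtains j j1 j2 :: "real \<Rightarrow> real" where
    "\<And>x. (j has_real_derivative j1 x) (at x)" "\<And>x. (j1 has_real_derivative j2 x) (at x)"
    "continuous_on UNIV j2" "\<And>x. x * j2 x + j1 x = m * j x" "j 0 = 1"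
proof -
  define c :: "nat \<Rightarrow> real" where "c n = m ^ n / (fact n)\<^sup>2" for n
  have sc: "summable (\<lambda>n. c n * x ^ n)" for x
  proof (rule summable_comparison_test)
    show "summable (\<lambda>n. inverse (fact n) * \<bar>m * x\<bar> ^ n)" by (rule summable_exp)
    have "norm (c n * x ^ n) \<le> inverse (fact n) * \<bar>m * x\<bar> ^ n" for n
    proof -
      have "norm (c n * x ^ n) = \<bar>m * x\<bar> ^ n * (1 / (fact n)\<^sup>2)"
        by (simp add: c_def abs_mult power_abs power_mult_distrib)
      also have "\<dots> \<le> \<bar>m * x\<bar> ^ n * inverse (fact n)"
        using fact_ge_1[of n, where 'a=real]
        by (intro mult_left_mono) (simp_all add: field_simps power2_eq_square)
      finally show ?thesis by (simp add: mult.commute mult_right_mono)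
    qed
    then show "\<exists>N. \<forall>n\<ge>N. norm (c n * x ^ n) \<le> inverse (fact n) * \<bar>m * x\<bar> ^ n" by blast
  qed
  note sc1 = termdiff_converges_all[OF sc]
  note sc2 = termdiff_converges_all[OF sc1]
  note sc3 = termdiff_converges_all[OF sc2]
  define j where "j x = (\<Sum>n. c n * x ^ n)" for x
  define j1 where "j1 x = (\<Sum>n. diffs c n * x ^ n)" for x
  define j2 where "j2 x = (\<Sum>n. diffs (diffs c) n * x ^ n)" for x
  show thesis
  proof
    show "(j has_real_derivative j1 x) (at x)" for x
      unfolding j_def j1_def by (rule termdiffs_strong_converges_everywhere[OF sc])
    show "(j1 has_real_derivative j2 x) (at x)" for x
      unfolding j1_def j2_def by (rule termdiffs_strong_converges_everywhere[OF sc1])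
    show "continuous_on UNIV j2"
      unfolding j2_def using termdiffs_strong_converges_everywhere[OF sc2]
      by (meson DERIV_continuous continuous_at_imp_continuous_on)
    have "j 0 = c 0" unfolding j_def by (rule powser_zero)
    then show "j 0 = 1" by (simp add: c_def)
    show "x * j2 x + j1 x = m * j x" for x
    proof -
      \<comment> \<open>The factor n makes \<open>e 0\<close> vanish, so the index shift caused by
        multiplying the series of \<open>j2\<close> by \<open>x\<close> costs no boundary
        term.\<close>
      define e where "e n = of_nat n * diffs c n * x ^ n" for n
      have "(\<lambda>n. diffs (diffs c) n * x ^ n) sums j2 x"
        unfolding j2_def using sc2 by (rule summable_sums)
      from sums_mult[OF this, of x]
      have "(\<lambda>n. e (Suc n)) sums (x * j2 x)"
        by (simp add: e_def diffs_def[of "diffs c"] mult_ac)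
      then have "e sums (x * j2 x)"
        by (subst (asm) sums_Suc_iff) (simp add: e_def)
      moreover have "(\<lambda>n. diffs c n * x ^ n) sums j1 x"
        unfolding j1_def using sc1 by (rule summable_sums)
      ultimately have "(\<lambda>n. e n + diffs c n * x ^ n) sums (x * j2 x + j1 x)"
        by (rule sums_add)
      moreover have "e n + diffs c n * x ^ n = m * (c n * x ^ n)" for n
      proof -
        have "e n + diffs c n * x ^ n = (of_nat (Suc n))\<^sup>2 * c (Suc n) * x ^ n"
          by (simp add: e_def diffs_def algebra_simps power2_eq_square)
        also have "(of_nat (Suc n))\<^sup>2 * c (Suc n) = m * c n"
          by (simp add: c_def power_mult_distrib divide_simps del: of_nat_Suc)
        finally show ?thesis by simp
      qed
      ultimately have "(\<lambda>n. m * (c n * x ^ n)) sums (x * j2 x + j1 x)" by simp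
      moreover have "(\<lambda>n. m * (c n * x ^ n)) sums (m * j x)"
        unfolding j_def using sc by (intro sums_mult summable_sums)
      ultimately show ?thesis by (rule sums_unique2)
    qed
  qed
qed

section \<open>Gradients of the factors of the Riemann integrand\<close>

lemma has_grad_mult:
  fixes f g :: "complex \<Rightarrow> complex"
  assumes "has_grad D f p q" "has_grad D g r s"
  shows "has_grad D (\<lambda>z. f z * g z) (\<lambda>z. f z * r z + p z * g z) (\<lambda>z. f z * s z + q z * g z)"
  unfolding has_grad_def
proof
  fix z assume "z \<in> D"
  then have "(f has_derivative (\<lambda>h. Re h *\<^sub>R p z + Im h *\<^sub>R q z)) (at z)"
    "(g has_derivative (\<lambda>h. Re h *\<^sub>R r z + Im h *\<^sub>R s z)) (at z)"
    using assms unfolding has_grad_def by auto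
  from has_derivative_mult[OF this]
  show "((\<lambda>z. f z * g z) has_derivative
      (\<lambda>h. Re h *\<^sub>R (f z * r z + p z * g z) + Im h *\<^sub>R (f z * s z + q z * g z))) (at z)"
    by (simp add: algebra_simps)
qed

lemma has_grad_cong:
  assumes "has_grad D f p q" "\<And>z. z \<in> D \<Longrightarrow> p z = r z" "\<And>z. z \<in> D \<Longrightarrow> q z = s z"
  shows "has_grad D f r s"
  using assms unfolding has_grad_def by simp

lemma has_grad_of_real_Im:
  assumes "\<And>y. (f has_real_derivative f' y) (at y)"
  shows "has_grad D (\<lambda>z. of_real (f (Im z)) :: complex) (\<lambda>z. 0) (\<lambda>z. of_real (f' (Im z)))"
  unfolding has_grad_def
proof
  fix z :: complex
  have "(Im has_derivative Im) (at z)"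
    by (rule bounded_linear_imp_has_derivative) (rule bounded_linear_Im)
  moreover have "(f has_derivative (\<lambda>h. f' (Im z) * h)) (at (Im z))"
    using assms unfolding has_field_derivative_def by simp
  ultimately have "((\<lambda>z. f (Im z)) has_derivative (\<lambda>h. f' (Im z) * Im h)) (at z)"
    by (rule has_derivative_compose)
  from bounded_linear.has_derivative[OF bounded_linear_of_real this]
  show "((\<lambda>z. of_real (f (Im z)) :: complex) has_derivative
      (\<lambda>h. Re h *\<^sub>R 0 + Im h *\<^sub>R of_real (f' (Im z)))) (at z)"
    by (simp add: scaleR_conv_of_real mult_ac)
qed

lemma has_grad_squeeze:
  assumes "has_grad D u p q"
  shows "has_grad {z. Complex (Re z) (Im z * s) \<in> D} (\<lambda>z. u (Complex (Re z) (Im z * s)))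
    (\<lambda>z. p (Complex (Re z) (Im z * s))) (\<lambda>z. s *\<^sub>R q (Complex (Re z) (Im z * s)))"
  unfolding has_grad_def
proof
  fix z assume "z \<in> {z. Complex (Re z) (Im z * s) \<in> D}"
  then have u: "(u has_derivative (\<lambda>h. Re h *\<^sub>R p (Complex (Re z) (Im z * s)) +
      Im h *\<^sub>R q (Complex (Re z) (Im z * s)))) (at (Complex (Re z) (Im z * s)))"
    using assms unfolding has_grad_def by auto
  have "bounded_linear (\<lambda>z. Complex (Re z) (Im z * s))"
    unfolding Complex_eq
    by (intro bounded_linear_add bounded_linear_compose[OF bounded_linear_of_real]
        bounded_linear_compose[OF bounded_linear_mult_right] bounded_linear_Re
        bounded_linear_compose[OF bounded_linear_mult_left] bounded_linear_Im)
  from has_derivative_compose[OF bounded_linear_imp_has_derivative[OF this] u]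
  show "((\<lambda>z. u (Complex (Re z) (Im z * s))) has_derivative
      (\<lambda>h. Re h *\<^sub>R p (Complex (Re z) (Im z * s)) + Im h *\<^sub>R s *\<^sub>R q (Complex (Re z) (Im z * s)))) (at z)"
    by simp
qed

text \<open>The extension at \<open>z\<close> integrates data over the vertical segment from
  \<open>cnj z\<close> to \<open>z\<close>. The set collects the points for which this domain of
  dependence stays inside \<open>D\<close>.\<close>

definition vhull :: "complex set \<Rightarrow> complex set" where
  "vhull D = {z. \<forall>s\<in>{-1..1}. Complex (Re z) (Im z * s) \<in> D}"

lemma open_vhull:
  assumes "open D"
  shows "open (vhull D)"
proof (subst open_subopen, intro ballI)
  fix z assume z: "z \<in> vhull D"
  define W where "W = (\<lambda>(z, s). Complex (Re z) (Im z * s)) -` D"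
  have "open W" unfolding W_def
    by (rule open_vimage[OF assms]) (auto intro!: continuous_intros simp: case_prod_unfold)
  moreover have "{z} \<times> {-1..1} \<subseteq> W" using z by (auto simp: W_def vhull_def)
  ultimately obtain X where "z \<in> X" "open X" "X \<times> {-1..1} \<subseteq> W"
    using Elementary_Topology.tube_lemma[of "{-1..1::real}" W z] by auto
  then show "\<exists>T. open T \<and> z \<in> T \<and> T \<subseteq> vhull D"
    by (intro exI[of _ X]) (auto simp: W_def vhull_def)
qed

text \<open>Each point slides vertically to the real axis without leaving the hull, and the axis is
  connected. So the identity theorem applies on the hull even when \<open>D\<close> has holes or
  several components.\<close>

lemma connected_vhull:
  assumes real: "\<And>t. of_real t \<in> D"
  shows "connected (vhull D)"
proof -
  have real': "of_real t \<in> vhull D" for t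
    using real[of t] by (simp add: vhull_def Complex_eq)
  have *: "connected_component (vhull D) z 0" if z: "z \<in> vhull D" for z
  proof -
    have "closed_segment z (of_real (Re z)) \<subseteq> vhull D"
    proof
      fix w assume "w \<in> closed_segment z (of_real (Re z))"
      then obtain u where u: "0 \<le> u" "u \<le> 1" "w = (1 - u) *\<^sub>R z + u *\<^sub>R of_real (Re z)"
        by (auto simp: in_segment)
      then have w: "Re w = Re z" "Im w = Im z * (1 - u)" unfolding u(3) by (simp_all add: algebra_simps)
      have "Complex (Re w) (Im w * s) \<in> D" if s: "s \<in> {-1..1}" for s
      proof -
        have "\<bar>(1 - u) * s\<bar> \<le> 1 * 1"
          unfolding abs_mult using u s by (intro mult_mono) auto
        then have "(1 - u) * s \<in> {-1..1}" by auto
        with z show ?thesis unfolding vhull_def w by (force simp: mult.assoc)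
      qed
      then show "w \<in> vhull D" by (simp add: vhull_def)
    qed
    then have "connected_component (vhull D) z (of_real (Re z))"
      unfolding connected_component_def
      by (intro exI[of _ "closed_segment z (of_real (Re z))"]) auto
    moreover have "connected_component (vhull D) (of_real (Re z)) 0"
    proof -
      have "connected (range (of_real :: real \<Rightarrow> complex))"
        by (intro connected_continuous_image continuous_intros connected_UNIV)
      moreover have "range of_real \<subseteq> vhull D" using real' by auto
      moreover have "0 \<in> range (of_real :: real \<Rightarrow> complex)" by (rule range_eqI[of _ _ 0]) simp
      ultimately show ?thesis unfolding connected_component_def by blast
    qed
    ultimately show ?thesis by (rule connected_component_trans)
  qed
  show ?thesis
    unfolding connected_iff_connected_component
    using * by (meson connected_component_sym connected_component_trans)
qed

lemma vhull_subset:
  assumes "z \<in> vhull D"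
  shows "z \<in> D" "cnj z \<in> D"
proof -
  have *: "Complex (Re z) (Im z * s) \<in> D" if "s \<in> {-1..1}" for s
    using assms that by (simp add: vhull_def)
  have "Complex (Re z) (Im z * (-1)) = cnj z" by (simp add: complex_eq_iff)
  then show "z \<in> D" "cnj z \<in> D" using *[of 1] *[of "-1"] by simp_all
qed

text \<open>The algebra behind the Cauchy-Riemann equation of the extension. The two sides differ by
  \<open>t * U\<close> times the Bessel relation plus \<open>t * J\<close> times the Helmholtz
  equation. On the right stands the derivative in \<open>s\<close> of a product, so the left side
  integrates to boundary terms.\<close>

lemma Cauchy_Riemann_kernel_identity:
  fixes t s J J1 J2 P Q U PQ PP QQ k :: complex
  assumes J: "4 * (t^2 * (1 - s^2) * J2 + J1) = k * J" and QQ: "PP + QQ + k * U = 0"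
  shows "(\<i> * P * J + t * \<i> * (s * PQ) * J + t * \<i> * P * (J1 * (2 * t * (1 - s^2))) + 4 * t * U * J1
      + 2 * t^2 * (s * Q) * J1 + 2 * t^2 * U * (J2 * (2 * t * (1 - s^2))))
      - \<i> * (t * (\<i> * PP * J) + 2 * t^2 * P * J1)
    = (\<i> * s * P - Q) * (J1 * (t^2 * (- 2 * s))) + (\<i> * s * (t * PQ) + \<i> * P - t * QQ) * J"
proof -
  have "(\<i> * P * J + t * \<i> * (s * PQ) * J + t * \<i> * P * (J1 * (2 * t * (1 - s^2))) + 4 * t * U * J1
      + 2 * t^2 * (s * Q) * J1 + 2 * t^2 * U * (J2 * (2 * t * (1 - s^2))))
      - \<i> * (t * (\<i> * PP * J) + 2 * t^2 * P * J1)
      - ((\<i> * s * P - Q) * (J1 * (t^2 * (- 2 * s))) + (\<i> * s * (t * PQ) + \<i> * P - t * QQ) * J)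
    = t * U * (4 * (t^2 * (1 - s^2) * J2 + J1) - k * J) + t * J * (PP + QQ + k * U)"
    by (simp add: algebra_simps power2_eq_square)
  then show ?thesis unfolding J QQ by simp
qed

text \<open>On complexified time \<open>t + i\<tau>\<close> the Helmholtz equation becomes the Klein--Gordon equation in \<open>(\<tau>, y)\<close>.
  The extension \<open>F\<close> is its Riemann representation with data \<open>u\<close>, \<open>i \<partial>\<^sub>x u\<close> at \<open>\<tau> = 0\<close>, evaluated at \<open>y = 0\<close>,
  with the integration over \<open>[-\<tau>, \<tau>]\<close> rescaled to \<open>[-1, 1]\<close>.\<close>

lemma helmholtz_holomorphic_extension:
  fixes u :: "complex \<Rightarrow> complex"
  assumes u: "helmholtz_on \<kappa> D u p q"
  obtains F where "F holomorphic_on vhull D" "\<And>t. F (of_real t) = u (of_real t)"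
    "\<And>\<tau>. (\<And>s. s \<in> {-1..1} \<Longrightarrow> u (\<i> * of_real (\<tau> * s)) = 0 \<and> p (\<i> * of_real (\<tau> * s)) = 0) \<Longrightarrow> F (\<i> * of_real \<tau>) = 0"
proof -
  from u obtain pp pq qp qq where
    p: "has_grad D p pp pq" and q: "has_grad D q qp qq"
    and cont: "continuous_on D pp" "continuous_on D pq" "continuous_on D qp" "continuous_on D qq"
    and eq: "\<And>z. z \<in> D \<Longrightarrow> pp z + qq z + \<kappa>\<^sup>2 *\<^sub>R u z = 0"
    and D: "open D" and ug: "has_grad D u p q"
    unfolding helmholtz_on_def by blast
  \<comment> \<open>The wave operator in (\<tau>, \<eta>) applied to j(\<tau>^2 - \<eta>^2) gives 4
    (x j'' + j'); this is the origin of the parameter \<open>\<kappa>\<^sup>2 / 4\<close>.\<close>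
  obtain j j1 j2 :: "real \<Rightarrow> real" where
    j: "\<And>x. (j has_real_derivative j1 x) (at x)" and j1: "\<And>x. (j1 has_real_derivative j2 x) (at x)"
    and j2: "continuous_on UNIV j2" and ode: "\<And>x. x * j2 x + j1 x = (\<kappa>\<^sup>2 / 4) * j x" and j0: "j 0 = 1"
    using modified_bessel_exists[of "\<kappa>\<^sup>2 / 4"] by metis
  define w where "w z s = Complex (Re z) (Im z * s)" for z :: complex and s
  define r where "r z s = (Im z)\<^sup>2 * (1 - s\<^sup>2)" for z :: complex and s :: real
  \<comment> \<open>With \<tau> = \<open>Im z\<close> and \<eta> = \<tau> s, the datum
    \<open>\<i> * p\<close> is paired with the Riemann function and the datum \<open>u\<close> with
    its \<tau>-derivative 2 \<tau> j1. One factor \<open>Im z\<close> in each term is the Jacobian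
    of the rescaling. \<open>hx\<close> and \<open>hy\<close> below are the formal partials of
    \<open>h\<close>.\<close>
  define h where "h z s = of_real (Im z) * (\<i> * p (w z s) * of_real (j (r z s)))
      + of_real (2 * (Im z)\<^sup>2) * u (w z s) * of_real (j1 (r z s))" for z s
  define hx where "hx z s = of_real (Im z) * (\<i> * pp (w z s) * of_real (j (r z s)))
      + of_real (2 * (Im z)\<^sup>2) * p (w z s) * of_real (j1 (r z s))" for z s
  define hy where "hy z s = \<i> * p (w z s) * of_real (j (r z s))
      + of_real (Im z) * \<i> * (of_real s * pq (w z s)) * of_real (j (r z s))
      + of_real (Im z) * \<i> * p (w z s) * of_real (j1 (r z s) * (2 * Im z * (1 - s\<^sup>2)))
      + of_real (4 * Im z) * u (w z s) * of_real (j1 (r z s))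
      + of_real (2 * (Im z)\<^sup>2) * (of_real s * q (w z s)) * of_real (j1 (r z s))
      + of_real (2 * (Im z)\<^sup>2) * u (w z s) * of_real (j2 (r z s) * (2 * Im z * (1 - s\<^sup>2)))" for z s
  define \<Omega> where "\<Omega> = vhull D"
  have w: "w z s \<in> D" if "z \<in> \<Omega>" "s \<in> {-1..1}" for z s
    using that by (simp add: \<Omega>_def vhull_def w_def)
  have \<Omega>: "open \<Omega>" unfolding \<Omega>_def by (rule open_vhull[OF D])
  have cw: "continuous_on (\<Omega> \<times> {-1..1}) (\<lambda>x. w (fst x) (snd x))"
    unfolding w_def by (intro continuous_intros)
  have cD: "continuous_on (\<Omega> \<times> {-1..1}) (\<lambda>x. f (w (fst x) (snd x)))"
    if "continuous_on D f" for f :: "complex \<Rightarrow> complex"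
    by (rule continuous_on_compose2[OF that cw]) (auto intro: w)
  have cr: "continuous_on (\<Omega> \<times> {-1..1}) (\<lambda>x. r (fst x) (snd x))"
    unfolding r_def by (intro continuous_intros)
  have cj: "continuous_on (\<Omega> \<times> {-1..1}) (\<lambda>x. f (r (fst x) (snd x)))"
    if "continuous_on UNIV f" for f :: "real \<Rightarrow> real"
    by (rule continuous_on_compose2[OF that cr]) auto
  have jc: "continuous_on UNIV j" "continuous_on UNIV j1"
    using j j1 by (meson DERIV_continuous continuous_at_imp_continuous_on)+
  note conts = cD[OF has_grad_continuous_on[OF ug]] cD[OF has_grad_continuous_on[OF p]]
    cD[OF has_grad_continuous_on[OF q]] cD[OF cont(1)] cD[OF cont(2)] cD[OF cont(3)] cD[OF cont(4)]
    cj[OF jc(1)] cj[OF jc(2)] cj[OF j2]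
  have ch: "continuous_on (\<Omega> \<times> {-1..1}) (\<lambda>(z, s). h z s)"
    and chx: "continuous_on (\<Omega> \<times> {-1..1}) (\<lambda>(z, s). hx z s)"
    and chy: "continuous_on (\<Omega> \<times> {-1..1}) (\<lambda>(z, s). hy z s)"
    unfolding h_def hx_def hy_def case_prod_unfold
    by (intro continuous_intros conts)+
  have hg: "has_grad \<Omega> (\<lambda>z. h z s) (\<lambda>z. hx z s) (\<lambda>z. hy z s)" if s: "s \<in> {-1..1}" for s
  proof -
    have sub: "\<Omega> \<subseteq> {z. Complex (Re z) (Im z * s) \<in> D}" using w s by (auto simp: w_def)
    have uw: "has_grad \<Omega> (\<lambda>z. u (w z s)) (\<lambda>z. p (w z s)) (\<lambda>z. s *\<^sub>R q (w z s))"
      unfolding w_def by (rule has_grad_subset[OF has_grad_squeeze[OF ug] sub])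
    have pw: "has_grad \<Omega> (\<lambda>z. p (w z s)) (\<lambda>z. pp (w z s)) (\<lambda>z. s *\<^sub>R pq (w z s))"
      unfolding w_def by (rule has_grad_subset[OF has_grad_squeeze[OF p] sub])
    have A: "has_grad \<Omega> (\<lambda>z. of_real (Im z) :: complex) (\<lambda>z. 0) (\<lambda>z. of_real 1)"
      by (rule has_grad_of_real_Im) simp
    have A2: "has_grad \<Omega> (\<lambda>z. of_real (2 * (Im z)\<^sup>2) :: complex) (\<lambda>z. 0) (\<lambda>z. of_real (4 * Im z))"
      by (rule has_grad_of_real_Im[where f="\<lambda>y. 2 * y\<^sup>2"]) (auto intro!: derivative_eq_intros)
    have I: "has_grad \<Omega> (\<lambda>z. \<i>) (\<lambda>z. 0) (\<lambda>z. 0)"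
      unfolding has_grad_def by simp
    have dr: "((\<lambda>y. y\<^sup>2 * (1 - s\<^sup>2)) has_real_derivative 2 * y * (1 - s\<^sup>2)) (at y)" for y
      by (auto intro!: derivative_eq_intros)
    have B: "has_grad \<Omega> (\<lambda>z. of_real (j (r z s)) :: complex) (\<lambda>z. 0)
        (\<lambda>z. of_real (j1 (r z s) * (2 * Im z * (1 - s\<^sup>2))))"
      unfolding r_def
      by (rule has_grad_of_real_Im[where f="\<lambda>y. j (y\<^sup>2 * (1 - s\<^sup>2))"]) (rule DERIV_chain2[OF j dr])
    have C: "has_grad \<Omega> (\<lambda>z. of_real (j1 (r z s)) :: complex) (\<lambda>z. 0)
        (\<lambda>z. of_real (j2 (r z s) * (2 * Im z * (1 - s\<^sup>2))))"
      unfolding r_def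
      by (rule has_grad_of_real_Im[where f="\<lambda>y. j1 (y\<^sup>2 * (1 - s\<^sup>2))"]) (rule DERIV_chain2[OF j1 dr])
    show ?thesis
      unfolding h_def
      by (rule has_grad_cong[OF has_grad_add[OF has_grad_mult[OF A has_grad_mult[OF has_grad_mult[OF I pw] B]]
            has_grad_mult[OF has_grad_mult[OF A2 uw] C]]])
        (simp_all add: hx_def hy_def scaleR_conv_of_real algebra_simps)
  qed
  define F where "F z = (1/2) *\<^sub>R (u z + u (cnj z)) + (1/2) *\<^sub>R integral {-1..1} (h z)" for z
  define Fx where "Fx z = (1/2) *\<^sub>R (p z + p (cnj z)) + (1/2) *\<^sub>R integral {-1..1} (hx z)" for z
  define Fy where "Fy z = (1/2) *\<^sub>R (q z + - q (cnj z)) + (1/2) *\<^sub>R integral {-1..1} (hy z)" for z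
  have sub: "\<Omega> \<subseteq> D" "\<Omega> \<subseteq> {z. cnj z \<in> D}" using vhull_subset unfolding \<Omega>_def by auto
  have "has_grad \<Omega> F Fx Fy"
    unfolding F_def Fx_def Fy_def
    by (intro has_grad_lincomb has_grad_add has_grad_integral \<Omega> hg ch chx chy
        has_grad_subset[OF ug sub(1)] has_grad_subset[OF has_grad_cnj[OF ug] sub(2)])
  moreover have "Fy z = \<i> * Fx z" if z: "z \<in> \<Omega>" for z
  proof -
    \<comment> \<open>An antiderivative in \<open>s\<close> of \<open>hy - \<i> * hx\<close>; its
      boundary values compensate the failure of the average of \<open>u z\<close> and
      \<open>u (cnj z)\<close> to be holomorphic.\<close>
    define P where "P s = (\<i> * of_real s * p (w z s) - q (w z s)) * of_real (j (r z s))" for s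
    have dP: "(P has_vector_derivative (hy z s - \<i> * hx z s)) (at s within {-1..1})" if s: "s \<in> {-1..1}" for s
    proof -
      let ?w = "w z s"
      have wD: "?w \<in> D" using w z s .
      have "((\<lambda>s. w z s) has_derivative (\<lambda>k. \<i> * of_real (Im z * k))) (at s)"
        unfolding w_def Complex_eq by (auto intro!: derivative_eq_intros)
      then have chain: "((\<lambda>s. f (w z s)) has_vector_derivative Im z *\<^sub>R fq ?w) (at s)"
        if "has_grad D f fp fq" for f fp fq :: "complex \<Rightarrow> complex"
      proof -
        have "(f has_derivative (\<lambda>h. Re h *\<^sub>R fp ?w + Im h *\<^sub>R fq ?w)) (at ?w)"
          using that wD unfolding has_grad_def by blast
        from has_derivative_compose[OF \<open>((\<lambda>s. w z s) has_derivative _) _\<close> this]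
        show ?thesis unfolding has_vector_derivative_def by (simp add: mult.commute)
      qed
      have "((\<lambda>s. j (r z s)) has_real_derivative j1 (r z s) * ((Im z)\<^sup>2 * (- 2 * s))) (at s)"
        unfolding r_def by (rule DERIV_chain2[OF j]) (auto intro!: derivative_eq_intros)
      then have "((\<lambda>s. of_real (j (r z s)) :: complex) has_vector_derivative
          of_real (j1 (r z s) * ((Im z)\<^sup>2 * (- 2 * s)))) (at s)"
        by (intro has_vector_derivative_of_real) (simp add: has_real_derivative_iff_has_vector_derivative)
      moreover have "((\<lambda>s. \<i> * of_real s * p (w z s) - q (w z s)) has_vector_derivative
          (\<i> * of_real s * (Im z *\<^sub>R pq ?w) + \<i> * p ?w - Im z *\<^sub>R qq ?w)) (at s)"
        by (auto intro!: derivative_eq_intros chain[OF p] chain[OF q] has_vector_derivative_of_real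
            simp: has_real_derivative_iff_has_vector_derivative[symmetric])
      ultimately have "(P has_vector_derivative
          ((\<i> * of_real s * p ?w - q ?w) * of_real (j1 (r z s) * ((Im z)\<^sup>2 * (- 2 * s))) +
           (\<i> * of_real s * (Im z *\<^sub>R pq ?w) + \<i> * p ?w - Im z *\<^sub>R qq ?w) * of_real (j (r z s)))) (at s)"
        unfolding P_def by (intro has_vector_derivative_mult)
      moreover have "(\<i> * of_real s * p ?w - q ?w) * of_real (j1 (r z s) * ((Im z)\<^sup>2 * (- 2 * s))) +
           (\<i> * of_real s * (Im z *\<^sub>R pq ?w) + \<i> * p ?w - Im z *\<^sub>R qq ?w) * of_real (j (r z s)) =
           hy z s - \<i> * hx z s"
      proof -
        have "4 * (r z s * j2 (r z s) + j1 (r z s)) = \<kappa>\<^sup>2 * j (r z s)"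
          unfolding ode by simp
        from arg_cong[OF this, of "of_real :: real \<Rightarrow> complex"]
        have "4 * ((of_real (Im z))\<^sup>2 * (1 - (of_real s)\<^sup>2) * of_real (j2 (r z s)) + of_real (j1 (r z s)))
            = of_real (\<kappa>\<^sup>2) * (of_real (j (r z s)) :: complex)"
          unfolding of_real_mult of_real_add of_real_numeral
          by (simp only: r_def of_real_mult of_real_diff of_real_power of_real_1)
        moreover have "pp ?w + qq ?w + of_real (\<kappa>\<^sup>2) * u ?w = 0"
          using eq[OF wD] by (simp add: scaleR_conv_of_real)
        ultimately show ?thesis
          using Cauchy_Riemann_kernel_identity[of "of_real (Im z)" "of_real s" "of_real (j2 (r z s))"
              "of_real (j1 (r z s))" "of_real (\<kappa>\<^sup>2)" "of_real (j (r z s))" "pp ?w" "qq ?w" "u ?w"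
              "p ?w" "pq ?w" "q ?w"]
          unfolding hy_def hx_def scaleR_conv_of_real
          by (simp only: of_real_mult of_real_diff of_real_power of_real_1 of_real_numeral of_real_minus)
      qed
      ultimately show ?thesis by (metis has_vector_derivative_at_within)
    qed
    have "((\<lambda>s. hy z s - \<i> * hx z s) has_integral (P 1 - P (-1))) {-1..1}"
      by (rule fundamental_theorem_of_calculus) (use dP in auto)
    moreover have slice: "f z integrable_on {-1..1}"
      if "continuous_on (\<Omega> \<times> {-1..1}) (\<lambda>(z, s). f z s)" for f :: "complex \<Rightarrow> real \<Rightarrow> complex"
    proof -
      have "continuous_on {-1..1} ((\<lambda>(z, s). f z s) \<circ> (\<lambda>s. (z, s)))"
        by (rule continuous_on_compose)
          (auto intro!: continuous_intros continuous_on_subset[OF that] simp: z)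
      then show ?thesis by (intro integrable_continuous_real) (simp add: o_def)
    qed
    have "((\<lambda>s. hy z s - \<i> * hx z s) has_integral
        (integral {-1..1} (hy z) - \<i> * integral {-1..1} (hx z))) {-1..1}"
      by (intro has_integral_diff has_integral_mult_right integrable_integral slice[OF chx] slice[OF chy])
    ultimately have "integral {-1..1} (hy z) - \<i> * integral {-1..1} (hx z) = P 1 - P (-1)"
      by (metis has_integral_unique)
    \<comment> \<open>Both endpoints lie on the characteristics, where the argument of
      \<open>j\<close> is 0; the normalization \<open>j 0 = 1\<close> makes the boundary terms match
      exactly.\<close>
    moreover have "w z 1 = z" "w z (-1) = cnj z" "r z 1 = 0" "r z (-1) = 0"
      by (simp_all add: w_def r_def complex_eq_iff)
    ultimately have "integral {-1..1} (hy z) = \<i> * integral {-1..1} (hx z) + (\<i> * p z - q z) + (\<i> * p (cnj z) + q (cnj z))"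
      by (simp add: P_def j0 algebra_simps)
    then have "q z + - q (cnj z) + integral {-1..1} (hy z)
        = \<i> * (p z + p (cnj z) + integral {-1..1} (hx z))"
      by (simp add: algebra_simps)
    then show ?thesis
      unfolding Fy_def Fx_def scaleR_add_right[symmetric] mult_scaleR_right by simp
  qed
  ultimately have hol: "F holomorphic_on vhull D"
    unfolding \<Omega>_def[symmetric] by (rule has_grad_imp_holomorphic[OF \<Omega>])
  have real: "F (of_real t) = u (of_real t)" for t
  proof -
    have "h (of_real t) = (\<lambda>s. 0)" by (simp add: h_def fun_eq_iff)
    then show ?thesis by (simp add: F_def scaleR_conv_of_real)
  qed
  have imag: "F (\<i> * of_real \<tau>) = 0"
    if 0: "\<And>s. s \<in> {-1..1} \<Longrightarrow> u (\<i> * of_real (\<tau> * s)) = 0 \<and> p (\<i> * of_real (\<tau> * s)) = 0" for \<tau>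
  proof -
    have "w (\<i> * of_real \<tau>) s = \<i> * of_real (\<tau> * s)" for s
      by (simp add: w_def complex_eq_iff)
    then have "h (\<i> * of_real \<tau>) s = 0" if "s \<in> {-1..1}" for s
      using 0[OF that] by (simp add: h_def)
    then have "integral {-1..1} (h (\<i> * of_real \<tau>)) = 0"
      by (intro integral_unique has_integral_is_0)
    moreover have "u (\<i> * of_real \<tau>) = 0" "u (cnj (\<i> * of_real \<tau>)) = 0"
      using 0[of 1] 0[of "-1"] by simp_all
    ultimately show ?thesis by (simp only: F_def) simp
  qed
  show thesis
  proof (rule that[of F])
    fix \<tau> assume "\<And>s. s \<in> {-1..1} \<Longrightarrow> u (\<i> * of_real (\<tau> * s)) = 0 \<and> p (\<i> * of_real (\<tau> * s)) = 0"
    then show "F (\<i> * of_real \<tau>) = 0" by (rule imag)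
  qed (rule hol real)+
qed

section \<open>Uniqueness on a line from the identity theorem\<close>

lemma of_real_islimpt:
  fixes c :: complex
  assumes "open J" "t \<in> J" "c \<noteq> 0"
  shows "c * of_real t islimpt ((\<lambda>x. c * of_real x) ` J)"
  unfolding islimpt_approachable
proof (intro allI impI)
  fix e :: real assume e: "e > 0"
  from assms obtain d where d: "d > 0" "ball t d \<subseteq> J" by (meson openE)
  define x where "x = t + min (e / (2 * cmod c)) (d / 2)"
  have pos: "min (e / (2 * cmod c)) (d / 2) > 0" using e d \<open>c \<noteq> 0\<close> by simp
  have "x \<in> ball t d" using pos d by (simp add: x_def dist_real_def min_less_iff_disj)
  then have xJ: "x \<in> J" using d by blast
  have "c * of_real x - c * of_real t = c * of_real (min (e / (2 * cmod c)) (d / 2))"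
    by (simp add: x_def algebra_simps)
  moreover have "cmod c * min (e / (2 * cmod c)) (d / 2) \<le> cmod c * (e / (2 * cmod c))"
    by (intro mult_left_mono) auto
  moreover have "cmod c * (e / (2 * cmod c)) = e / 2" using \<open>c \<noteq> 0\<close> by simp
  moreover have "x > t" using pos unfolding x_def by linarith
  ultimately show "\<exists>x'\<in>(\<lambda>x. c * of_real x) ` J. x' \<noteq> c * of_real t \<and> dist x' (c * of_real t) < e"
    using e pos xJ assms(3)
    by (intro bexI[of _ "c * of_real x"]) (auto simp: dist_norm norm_mult)
qed

text \<open>On the real axis \<open>u\<close> agrees with a function holomorphic on a connected
  neighbourhood of the whole axis. Only the axis has to lie in \<open>D\<close>; its component
  structure does not matter.\<close>

lemma helmholtz_real_axis_uniqueness: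
  fixes u :: "complex \<Rightarrow> complex"
  assumes u: "helmholtz_on \<kappa> D u p q" and real: "\<And>t. of_real t \<in> D"
    and J: "open J" "J \<noteq> {}" "\<And>t. t \<in> J \<Longrightarrow> u (of_real t) = 0"
  shows "u (of_real t) = 0"
proof -
  obtain F where F: "F holomorphic_on vhull D" "\<And>t. F (of_real t) = u (of_real t)"
    using helmholtz_holomorphic_extension[OF u] by metis
  have in_hull: "of_real t \<in> vhull D" for t using real[of t] by (simp add: vhull_def Complex_eq)
  from J obtain t0 where t0: "t0 \<in> J" by blast
  have "open D" using u by (simp add: helmholtz_on_def)
  have "F (of_real t) = 0"
  proof (rule analytic_continuation[OF F(1) open_vhull[OF \<open>open D\<close>] connected_vhull[OF real]])
    show "(1 * of_real t0 :: complex) islimpt ((\<lambda>x. 1 * of_real x) ` J)"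
      by (rule of_real_islimpt[OF J(1) t0]) simp
  qed (use in_hull J(3) F(2) in auto)
  then show ?thesis using F(2) by simp
qed

text \<open>A substitute for Holmgren's theorem. Zero Cauchy data on the imaginary axis make the
  extension vanish at small imaginary times, and analytic continuation carries this zero to all real
  times.\<close>

lemma helmholtz_real_axis_zero_Cauchy_data:
  fixes u :: "complex \<Rightarrow> complex"
  assumes u: "helmholtz_on \<kappa> D u p q" and real: "\<And>t. of_real t \<in> D"
    and u0: "\<And>y. u (\<i> * of_real y) = 0" and p0: "\<And>y. p (\<i> * of_real y) = 0"
  shows "u (of_real t) = 0"
proof -
  obtain F where F: "F holomorphic_on vhull D" "\<And>t. F (of_real t) = u (of_real t)"
    "\<And>\<tau>. F (\<i> * of_real \<tau>) = 0"
    using helmholtz_holomorphic_extension[OF u] u0 p0 by metis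
  have in_hull: "of_real t \<in> vhull D" for t using real[of t] by (simp add: vhull_def Complex_eq)
  have "open D" using u by (simp add: helmholtz_on_def)
  then have "open (vhull D)" by (rule open_vhull)
  then obtain \<delta> where \<delta>: "\<delta> > 0" "ball 0 \<delta> \<subseteq> vhull D"
    using in_hull[of 0] by (auto elim!: openE)
  have "F (of_real t) = 0"
  proof (rule analytic_continuation[OF F(1) \<open>open (vhull D)\<close> connected_vhull[OF real]])
    have "(\<i> * of_real 0) islimpt ((\<lambda>x. \<i> * of_real x) ` ball 0 \<delta>)"
      by (rule of_real_islimpt) (use \<delta> in auto)
    then show "0 islimpt ((\<lambda>x. \<i> * of_real x) ` ball 0 \<delta>)" by simp
    show "(\<lambda>x. \<i> * complex_of_real x) ` ball 0 \<delta> \<subseteq> vhull D"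
      using \<delta>(2) by (force simp: dist_norm norm_mult)
  qed (use in_hull[of 0] in_hull[of t] F(3) in auto)
  then show ?thesis using F(2) by simp
qed

section \<open>Rellich uniqueness for angular modes\<close>

text \<open>The oscillator energy \<open>E\<close> changes only at the integrable rate O(E/s^2), so
  a positive energy stays bounded away from 0. Decay of \<open>w\<close> forces, by the mean value
  theorem, points far out where \<open>w\<close> and its derivative are both small, a
  contradiction.\<close>

lemma decaying_oscillator_zero:
  fixes w w1 :: "real \<Rightarrow> real"
  assumes \<kappa>: "\<kappa> > 0" and R: "R \<ge> 0"
    and w: "\<And>r. r > R \<Longrightarrow> (w has_real_derivative w1 r) (at r)"
    and w1: "\<And>r. r > R \<Longrightarrow> (w1 has_real_derivative - (\<kappa>\<^sup>2 - m / r\<^sup>2) * w r) (at r)"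
    and lim: "(w \<longlongrightarrow> 0) at_top"
    and r: "r > R"
  shows "w r = 0"
proof (rule ccontr)
  assume "w r \<noteq> 0"
  \<comment> \<open>The derivative of \<open>E\<close> is 2 m w w1 / s^2, at most
    \<open>\<mu> * E s / s\<^sup>2\<close> in absolute value by the inequality of means. The weight
    exp(-\<mu>/s) in \<open>Q\<close> absorbs this loss and makes \<open>Q\<close>
    nondecreasing.\<close>
  define \<mu> where "\<mu> = \<bar>m\<bar> / \<kappa>"
  define E where "E s = (w1 s)\<^sup>2 + \<kappa>\<^sup>2 * (w s)\<^sup>2" for s
  define Q where "Q s = E s * exp (- \<mu> / s)" for s
  have "\<mu> \<ge> 0" using \<kappa> by (simp add: \<mu>_def)
  have dQ: "\<exists>y. (Q has_real_derivative y) (at s) \<and> 0 \<le> y" if s: "s > R" for s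
  proof -
    have "s > 0" using s R by simp
    have dE: "(E has_real_derivative 2 * w1 s * (- (\<kappa>\<^sup>2 - m / s\<^sup>2) * w s) + \<kappa>\<^sup>2 * (2 * w s * w1 s)) (at s)"
      unfolding E_def by (auto intro!: derivative_eq_intros w[OF s] w1[OF s])
    have "((\<lambda>s. exp (- \<mu> / s)) has_real_derivative exp (- \<mu> / s) * (\<mu> / s\<^sup>2)) (at s)"
      using \<open>s > 0\<close> by (auto intro!: derivative_eq_intros simp: power2_eq_square)
    from DERIV_mult[OF dE this]
    have "(Q has_real_derivative (2 * w1 s * (- (\<kappa>\<^sup>2 - m / s\<^sup>2) * w s) + \<kappa>\<^sup>2 * (2 * w s * w1 s)) * exp (- \<mu> / s)
        + exp (- \<mu> / s) * (\<mu> / s\<^sup>2) * E s) (at s)"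
      unfolding Q_def .
    moreover have "(2 * w1 s * (- (\<kappa>\<^sup>2 - m / s\<^sup>2) * w s) + \<kappa>\<^sup>2 * (2 * w s * w1 s)) * exp (- \<mu> / s)
        + exp (- \<mu> / s) * (\<mu> / s\<^sup>2) * E s = exp (- \<mu> / s) / s\<^sup>2 * (2 * m * w s * w1 s + \<mu> * E s)"
      using \<open>s > 0\<close> by (simp add: field_simps)
    moreover have "0 \<le> 2 * m * w s * w1 s + \<mu> * E s"
    proof -
      have "0 \<le> (\<bar>w1 s\<bar> - \<kappa> * \<bar>w s\<bar>)\<^sup>2" by simp
      then have "2 * (\<kappa> * \<bar>w s\<bar> * \<bar>w1 s\<bar>) \<le> E s"
        by (simp add: E_def power2_eq_square algebra_simps)
      then have "\<bar>m\<bar> * (2 * (\<kappa> * \<bar>w s\<bar> * \<bar>w1 s\<bar>)) \<le> \<bar>m\<bar> * E s"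
        by (intro mult_left_mono) auto
      then have "2 * (\<bar>m\<bar> * \<bar>w s\<bar> * \<bar>w1 s\<bar>) \<le> \<mu> * E s"
        using \<kappa> by (simp add: \<mu>_def field_simps)
      moreover have "- (2 * m * w s * w1 s) \<le> 2 * (\<bar>m\<bar> * \<bar>w s\<bar> * \<bar>w1 s\<bar>)"
        using abs_ge_minus_self[of "m * w s * w1 s"] by (simp add: abs_mult)
      ultimately show ?thesis by simp
    qed
    ultimately show ?thesis
      by (metis divide_nonneg_nonneg exp_ge_zero mult_nonneg_nonneg zero_le_power2)
  qed
  have "E r > 0"
    using \<open>w r \<noteq> 0\<close> \<kappa> unfolding E_def by (simp add: add_nonneg_pos)
  define c where "c = Q r"
  have "c > 0" using \<open>E r > 0\<close> by (simp add: c_def Q_def)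
  have E_ge: "E s \<ge> c" if "s \<ge> r" for s
  proof -
    have "Q r \<le> Q s"
      by (rule DERIV_nonneg_imp_nondecreasing[OF that]) (use dQ r in auto)
    also have "\<dots> \<le> E s * 1"
      unfolding Q_def using \<open>\<mu> \<ge> 0\<close> that r R
      by (intro mult_left_mono) (auto simp: E_def)
    finally show ?thesis by (simp add: c_def)
  qed
  \<comment> \<open>Chosen so that |w1| < 2 \<epsilon> and |w| < \<epsilon> at one point give an
    energy below (4 + \<kappa>^2) \<epsilon>^2 = c.\<close>
  define \<epsilon> where "\<epsilon> = sqrt (c / (4 + \<kappa>\<^sup>2))"
  have k4: "4 + \<kappa>\<^sup>2 > 0" by (simp add: add_pos_nonneg)
  have "\<epsilon> > 0" using \<open>c > 0\<close> k4 by (simp add: \<epsilon>_def)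
  have \<epsilon>2: "(4 + \<kappa>\<^sup>2) * \<epsilon>\<^sup>2 = c" using \<open>c > 0\<close> k4 by (simp add: \<epsilon>_def)
  from tendstoD[OF lim \<open>\<epsilon> > 0\<close>] obtain N where N: "\<And>s. s \<ge> N \<Longrightarrow> \<bar>w s\<bar> < \<epsilon>"
    by (auto simp: eventually_at_top_linorder)
  define a where "a = max N r"
  have "\<exists>\<xi>. a < \<xi> \<and> \<xi> < a + 1 \<and> w (a + 1) - w a = (a + 1 - a) * w1 \<xi>"
    by (rule MVT2) (use w r in \<open>auto simp: a_def\<close>)
  then obtain \<xi> where \<xi>: "a < \<xi>" "w1 \<xi> = w (a + 1) - w a" by auto
  have "\<bar>w (a + 1)\<bar> < \<epsilon>" "\<bar>w a\<bar> < \<epsilon>" "\<bar>w \<xi>\<bar> < \<epsilon>" using N \<xi>(1) by (auto simp: a_def)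
  then have "\<bar>w1 \<xi>\<bar> < 2 * \<epsilon>" "\<bar>w \<xi>\<bar> < \<epsilon>" using \<xi>(2) by auto
  then have "(w1 \<xi>)\<^sup>2 < (2 * \<epsilon>)\<^sup>2" "(w \<xi>)\<^sup>2 \<le> \<epsilon>\<^sup>2"
    by (metis abs_ge_zero power2_abs power_strict_mono zero_less_numeral,
        metis abs_ge_zero power2_abs power_mono less_imp_le)
  then have "E \<xi> < 4 * \<epsilon>\<^sup>2 + \<kappa>\<^sup>2 * \<epsilon>\<^sup>2"
    unfolding E_def by (intro add_less_le_mono mult_left_mono) (auto simp: power_mult_distrib)
  also have "\<dots> = c" using \<epsilon>2 by (simp add: algebra_simps)
  finally show False using E_ge[of \<xi>] \<xi>(1) by (simp add: a_def)
qed

text \<open>Liouville's substitution w = sqrt(r) p removes the first-order term of Bessel's equation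
  and shifts \<open>n\<close>, the square of the order, by 1/4. The decay rate o(1/sqrt r) is then
  exactly w \<longrightarrow> 0.\<close>

lemma decaying_Bessel_zero:
  fixes p p1 :: "real \<Rightarrow> real"
  assumes \<kappa>: "\<kappa> > 0" and R: "R \<ge> 0"
    and p: "\<And>r. r > R \<Longrightarrow> (p has_real_derivative p1 r) (at r)"
    and p1: "\<And>r. r > R \<Longrightarrow> (p1 has_real_derivative p2 r) (at r)"
    and ode: "\<And>r. r > R \<Longrightarrow> r\<^sup>2 * p2 r + r * p1 r + (\<kappa>\<^sup>2 * r\<^sup>2 - n) * p r = 0"
    and lim: "((\<lambda>r. sqrt r * p r) \<longlongrightarrow> 0) at_top"
    and r: "r > R"
  shows "p r = 0"
proof -
  have "sqrt r * p r = 0"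
  proof (rule decaying_oscillator_zero[OF \<kappa> R _ _ lim r, where m = "n - 1/4"])
    fix s assume s: "s > R"
    then have "s > 0" using R by simp
    show "((\<lambda>r. sqrt r * p r) has_real_derivative sqrt s * p1 s + p s / (2 * sqrt s)) (at s)"
      using \<open>s > 0\<close> by (auto intro!: derivative_eq_intros p[OF s] simp: field_simps)
    have "((\<lambda>s. sqrt s * p1 s + p s / (2 * sqrt s)) has_real_derivative
        sqrt s * p2 s + p1 s / sqrt s - p s / (4 * s * sqrt s)) (at s)"
      using \<open>s > 0\<close>
      by (auto intro!: derivative_eq_intros p[OF s] p1[OF s] simp: field_simps)
    moreover have "sqrt s * p2 s + p1 s / sqrt s - p s / (4 * s * sqrt s)
      = - (\<kappa>\<^sup>2 - (n - 1/4) / s\<^sup>2) * (sqrt s * p s)"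
    proof -
      \<comment> \<open>In terms of the square root all powers become integral, so the identity is a
        rational one.\<close>
      define x where "x = sqrt s"
      have x: "x > 0" "s = x^2" using \<open>s > 0\<close> by (simp_all add: x_def)
      have "x^4 * p2 s + x^2 * p1 s + (\<kappa>\<^sup>2 * x^4 - n) * p s = 0"
        using ode[OF s] unfolding x(2) by simp
      then have "4 * x^4 * p2 s + 4 * x^2 * p1 s - p s = - (4 * \<kappa>\<^sup>2 * x^4 - (4 * n - 1)) * p s"
        by (simp add: algebra_simps)
      moreover have "sqrt s = x" by (simp add: x_def)
      moreover have "x * p2 s + p1 s / x - p s / (4 * x^2 * x) =
          (4 * x^4 * p2 s + 4 * x^2 * p1 s - p s) / (4 * x^3)"
        using x(1) by (simp add: field_simps power2_eq_square power3_eq_cube power4_eq_xxxx)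
      moreover have "- (\<kappa>\<^sup>2 - (n - 1/4) / (x^2)\<^sup>2) * (x * p s) =
          - (4 * \<kappa>\<^sup>2 * x^4 - (4 * n - 1)) * p s / (4 * x^3)"
        using x(1) by (simp add: field_simps power2_eq_square power3_eq_cube power4_eq_xxxx)
      ultimately show ?thesis using x(2) by simp
    qed
    ultimately show "((\<lambda>s. sqrt s * p1 s + p s / (2 * sqrt s)) has_real_derivative
        - (\<kappa>\<^sup>2 - (n - 1/4) / s\<^sup>2) * (sqrt s * p s)) (at s)" by simp
  qed
  then show ?thesis using r R by simp
qed

section \<open>Angular modes of a Helmholtz function\<close>

lemma has_grad_chain:
  assumes "has_grad D u p q" "(\<gamma> has_vector_derivative v) (at t)" "\<gamma> t \<in> D"
  shows "((\<lambda>t. u (\<gamma> t)) has_vector_derivative Re v *\<^sub>R p (\<gamma> t) + Im v *\<^sub>R q (\<gamma> t)) (at t)"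
proof -
  have "(u has_derivative (\<lambda>h. Re h *\<^sub>R p (\<gamma> t) + Im h *\<^sub>R q (\<gamma> t))) (at (\<gamma> t))"
    using assms unfolding has_grad_def by blast
  from has_derivative_compose[OF assms(2)[unfolded has_vector_derivative_def] this]
  show ?thesis unfolding has_vector_derivative_def by (simp add: algebra_simps)
qed

lemma rcis_radial_derivative: "((\<lambda>r. rcis r \<phi>) has_vector_derivative cis \<phi>) (at r within S)"
  unfolding rcis_def
  using has_vector_derivative_mult_left[OF has_vector_derivative_of_real[OF DERIV_ident], of "cis \<phi>"]
  by simp

lemma rcis_angular_derivative: "(rcis r has_vector_derivative \<i> * rcis r \<phi>) (at \<phi> within S)"
proof -
  have "((\<lambda>\<phi>. cis \<phi>) has_vector_derivative \<i> * cis \<phi>) (at \<phi> within S)"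
    unfolding has_vector_derivative_def by (rule has_derivative_cis[OF has_derivative_ident])
  then have "((\<lambda>\<phi>. of_real r * cis \<phi>) has_vector_derivative of_real r * (\<i> * cis \<phi>)) (at \<phi> within S)"
    by (rule has_vector_derivative_mult_right)
  then show ?thesis unfolding rcis_def[abs_def] by (simp add: mult_ac)
qed

text \<open>Separation of variables by testing: radial derivatives pass under the integral, and two
  integrations by parts move the angular ones onto \<open>e\<close>, where they produce the factor
  \<open>- n\<close>. Periodicity removes the boundary terms.\<close>

lemma angular_mode_Bessel:
  fixes u :: "complex \<Rightarrow> real" and e e1 :: "real \<Rightarrow> real"
  assumes u: "helmholtz_on \<kappa> D u p q" and R: "R \<ge> 0" "\<And>z. cmod z > R \<Longrightarrow> z \<in> D"
    and e: "\<And>\<phi>. (e has_real_derivative e1 \<phi>) (at \<phi>)" "\<And>\<phi>. (e1 has_real_derivative - n * e \<phi>) (at \<phi>)"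
    and per: "e (2 * pi) = e 0" "e1 (2 * pi) = e1 0"
  obtains P1 P2 where
    "\<And>r. r > R \<Longrightarrow> ((\<lambda>r. integral {0..2*pi} (\<lambda>\<phi>. u (rcis r \<phi>) * e \<phi>)) has_real_derivative P1 r) (at r)"
    "\<And>r. r > R \<Longrightarrow> (P1 has_real_derivative P2 r) (at r)"
    "\<And>r. r > R \<Longrightarrow> r\<^sup>2 * P2 r + r * P1 r
        + (\<kappa>\<^sup>2 * r\<^sup>2 - n) * integral {0..2*pi} (\<lambda>\<phi>. u (rcis r \<phi>) * e \<phi>) = 0"
proof -
  from u obtain pp pq qp qq where
    p: "has_grad D p pp pq" and q: "has_grad D q qp qq"
    and cont: "continuous_on D pp" "continuous_on D pq" "continuous_on D qp" "continuous_on D qq"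
    and eq: "\<And>z. z \<in> D \<Longrightarrow> pp z + qq z + \<kappa>\<^sup>2 *\<^sub>R u z = 0"
    and D: "open D" and ug: "has_grad D u p q"
    unfolding helmholtz_on_def by blast
  have inD: "rcis r \<phi> \<in> D" if "r > R" for r \<phi>
    using that R by (intro R(2)) simp
  define ur where "ur r \<phi> = cos \<phi> * p (rcis r \<phi>) + sin \<phi> * q (rcis r \<phi>)" for r \<phi>
  define urr where "urr r \<phi> = cos \<phi> * (cos \<phi> * pp (rcis r \<phi>) + sin \<phi> * pq (rcis r \<phi>))
      + sin \<phi> * (cos \<phi> * qp (rcis r \<phi>) + sin \<phi> * qq (rcis r \<phi>))" for r \<phi>
  have radial: "((\<lambda>r. f (rcis r \<phi>)) has_real_derivative cos \<phi> * fp (rcis r \<phi>) + sin \<phi> * fq (rcis r \<phi>)) (at r)"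
    if "has_grad D f fp fq" "r > R" for f fp fq :: "complex \<Rightarrow> real" and r \<phi>
    using has_grad_chain[where \<gamma> = "\<lambda>r. rcis r \<phi>", OF that(1) rcis_radial_derivative inD[OF that(2)]]
    by (simp add: has_real_derivative_iff_has_vector_derivative)
  have angular: "((\<lambda>\<phi>. f (rcis r \<phi>)) has_real_derivative
      r * (- sin \<phi> * fp (rcis r \<phi>) + cos \<phi> * fq (rcis r \<phi>))) (at \<phi>)"
    if "has_grad D f fp fq" "r > R" for f fp fq :: "complex \<Rightarrow> real" and r \<phi>
    using has_grad_chain[where \<gamma> = "rcis r", OF that(1) rcis_angular_derivative inD[OF that(2)]]
    by (simp add: has_real_derivative_iff_has_vector_derivative algebra_simps)
  have ec: "continuous_on UNIV e"
    using e(1) by (meson DERIV_continuous continuous_at_imp_continuous_on)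
  have rc: "continuous_on S (\<lambda>x. rcis (fst x) (snd x))" for S :: "(real \<times> real) set"
    unfolding rcis_def cis_conv_exp by (intro continuous_intros)
  have cD: "continuous_on ({R<..} \<times> T) (\<lambda>x. f (rcis (fst x) (snd x)))"
    if "continuous_on D f" for f :: "complex \<Rightarrow> real" and T :: "real set"
    by (rule continuous_on_compose2[OF that rc]) (auto intro: inD)
  have ec2: "continuous_on S (\<lambda>x. e (snd x))" for S :: "(real \<times> real) set"
    by (rule continuous_on_compose2[OF ec]) (auto intro!: continuous_intros)
  note conts = cD[OF has_grad_continuous_on[OF ug]] cD[OF has_grad_continuous_on[OF p]]
    cD[OF has_grad_continuous_on[OF q]] cD[OF cont(1)] cD[OF cont(2)] cD[OF cont(3)] cD[OF cont(4)] ec2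
  have c0: "continuous_on ({R<..} \<times> T) (\<lambda>x. u (rcis (fst x) (snd x)) * e (snd x))"
    and c1: "continuous_on ({R<..} \<times> T) (\<lambda>x. ur (fst x) (snd x) * e (snd x))"
    and c2: "continuous_on ({R<..} \<times> T) (\<lambda>x. urr (fst x) (snd x) * e (snd x))" for T
    unfolding ur_def urr_def by (intro continuous_intros conts)+
  have slice: "(\<lambda>\<phi>. f r \<phi>) integrable_on {0..2*pi}"
    if "continuous_on ({R<..} \<times> {0..2*pi}) (\<lambda>x. f (fst x) (snd x))" "r > R" for f :: "real \<Rightarrow> real \<Rightarrow> real" and r
  proof -
    have "continuous_on {0..2*pi} ((\<lambda>x. f (fst x) (snd x)) \<circ> (\<lambda>s. (r, s)))"
      by (rule continuous_on_compose)
        (auto intro!: continuous_intros continuous_on_subset[OF that(1)] simp: that(2))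
    then show ?thesis by (intro integrable_continuous_real) (simp add: o_def)
  qed
  have leibniz: "((\<lambda>r. integral {0..2*pi} (f r)) has_real_derivative integral {0..2*pi} (f1 r)) (at r)"
    if d: "\<And>r \<phi>. r > R \<Longrightarrow> ((\<lambda>r. f r \<phi>) has_real_derivative f1 r \<phi>) (at r)"
      and cf: "continuous_on ({R<..} \<times> {0..2*pi}) (\<lambda>x. f (fst x) (snd x))"
      and cf1: "continuous_on ({R<..} \<times> {0..2*pi}) (\<lambda>x. f1 (fst x) (snd x))"
      and r: "r > R" for f f1 :: "real \<Rightarrow> real \<Rightarrow> real" and r
  proof -
    have "((\<lambda>r. integral (cbox 0 (2*pi)) (f r)) has_real_derivative integral (cbox 0 (2*pi)) (f1 r))
        (at r within {R<..})"
    proof (rule leibniz_rule_field_derivative)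
      show "((\<lambda>r. f r \<phi>) has_real_derivative f1 r \<phi>) (at r within {R<..})"
        if "r \<in> {R<..}" for r \<phi> using d that by (auto intro: has_field_derivative_at_within)
      show "f r integrable_on cbox 0 (2*pi)" if "r \<in> {R<..}" for r
        using slice[OF cf] that by simp
      show "continuous_on ({R<..} \<times> cbox 0 (2*pi)) (\<lambda>(r, \<phi>). f1 r \<phi>)"
        using cf1 by (simp add: case_prod_unfold)
    qed (use r in auto)
    then show ?thesis using r by (simp add: at_within_open[of r "{R<..}"])
  qed
  let ?P = "\<lambda>r. integral {0..2*pi} (\<lambda>\<phi>. u (rcis r \<phi>) * e \<phi>)"
  let ?P1 = "\<lambda>r. integral {0..2*pi} (\<lambda>\<phi>. ur r \<phi> * e \<phi>)"
  let ?P2 = "\<lambda>r. integral {0..2*pi} (\<lambda>\<phi>. urr r \<phi> * e \<phi>)"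
  show thesis
  proof
    show "(?P has_real_derivative ?P1 r) (at r)" if "r > R" for r
      by (rule leibniz[OF _ c0 c1 that]) (auto simp: ur_def intro!: DERIV_cmult_right radial[OF ug])
    show "(?P1 has_real_derivative ?P2 r) (at r)" if "r > R" for r
    proof (rule leibniz[OF _ c1 c2 that])
      fix r \<phi> assume r: "r > R"
      show "((\<lambda>r. ur r \<phi> * e \<phi>) has_real_derivative urr r \<phi> * e \<phi>) (at r)"
        unfolding ur_def urr_def
        by (intro DERIV_cmult_right DERIV_add DERIV_cmult radial[OF p r] radial[OF q r])
    qed
    show "r\<^sup>2 * ?P2 r + r * ?P1 r + (\<kappa>\<^sup>2 * r\<^sup>2 - n) * ?P r = 0" if r: "r > R" for r
    proof -
      \<comment> \<open>The angular derivative of \<open>u\<close> on the circle of radius r. Both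
        integrations by parts are done at once: the derivative of \<open>up * e - u * e1\<close> is
        minus the integrand of the Bessel equation.\<close>
      define up where "up \<phi> = r * (- sin \<phi> * p (rcis r \<phi>) + cos \<phi> * q (rcis r \<phi>))" for \<phi>
      have d: "((\<lambda>\<phi>. up \<phi> * e \<phi> - u (rcis r \<phi>) * e1 \<phi>) has_real_derivative
          - (r\<^sup>2 * (urr r \<phi> * e \<phi>) + r * (ur r \<phi> * e \<phi>) + (\<kappa>\<^sup>2 * r\<^sup>2 - n) * (u (rcis r \<phi>) * e \<phi>))) (at \<phi>)" for \<phi>
      proof -
        let ?z = "rcis r \<phi>"
        define p\<phi> where "p\<phi> = r * (- sin \<phi> * pp ?z + cos \<phi> * pq ?z)"
        define q\<phi> where "q\<phi> = r * (- sin \<phi> * qp ?z + cos \<phi> * qq ?z)"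
        have "((\<lambda>\<phi>. - sin \<phi> * p (rcis r \<phi>)) has_real_derivative - sin \<phi> * p\<phi> + - cos \<phi> * p ?z) (at \<phi>)"
          unfolding p\<phi>_def by (rule DERIV_mult'[OF _ angular[OF p r]]) (auto intro!: derivative_eq_intros)
        moreover have "((\<lambda>\<phi>. cos \<phi> * q (rcis r \<phi>)) has_real_derivative cos \<phi> * q\<phi> + - sin \<phi> * q ?z) (at \<phi>)"
          unfolding q\<phi>_def by (rule DERIV_mult'[OF _ angular[OF q r]]) (auto intro!: derivative_eq_intros)
        ultimately have dup: "(up has_real_derivative r * ((- sin \<phi> * p\<phi> + - cos \<phi> * p ?z) + (cos \<phi> * q\<phi> + - sin \<phi> * q ?z))) (at \<phi>)"
          unfolding up_def by (intro DERIV_cmult DERIV_add)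
        have du: "((\<lambda>\<phi>. u (rcis r \<phi>)) has_real_derivative up \<phi>) (at \<phi>)"
          unfolding up_def by (rule angular[OF ug r])
        have cs: "cos \<phi> * cos \<phi> = 1 - sin \<phi> * sin \<phi>"
          using sin_cos_squared_add[of \<phi>] by (simp add: power2_eq_square)
        have qq: "qq ?z = - pp ?z - \<kappa>\<^sup>2 * u ?z" using eq[OF inD[OF r, of \<phi>]] by simp
        \<comment> \<open>The Laplacian in polar coordinates: u_\<phi>\<phi> + r^2 u_rr + r u_r =
          r^2 (u_xx + u_yy). The mixed terms from the angular and radial second derivatives
          cancel.\<close>
        have "r * ((- sin \<phi> * p\<phi> + - cos \<phi> * p ?z) + (cos \<phi> * q\<phi> + - sin \<phi> * q ?z))
            + r\<^sup>2 * urr r \<phi> + r * ur r \<phi> = r\<^sup>2 * (cos \<phi> * cos \<phi> * (pp ?z + qq ?z) + sin \<phi> * sin \<phi> * (pp ?z + qq ?z))"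
          unfolding p\<phi>_def q\<phi>_def urr_def ur_def by (simp add: algebra_simps power2_eq_square)
        also have "\<dots> = - (\<kappa>\<^sup>2 * r\<^sup>2 * u ?z)" unfolding cs qq by (simp add: algebra_simps)
        finally have *: "r * ((- sin \<phi> * p\<phi> + - cos \<phi> * p ?z) + (cos \<phi> * q\<phi> + - sin \<phi> * q ?z))
            = - (r\<^sup>2 * urr r \<phi> + r * ur r \<phi> + \<kappa>\<^sup>2 * r\<^sup>2 * u ?z)" by linarith
        show ?thesis
          by (rule DERIV_cong[OF DERIV_diff[OF DERIV_mult[OF dup e(1)] DERIV_mult[OF du e(2)]]])
            (unfold *, simp add: algebra_simps)
      qed
      have "((\<lambda>\<phi>. - (r\<^sup>2 * (urr r \<phi> * e \<phi>) + r * (ur r \<phi> * e \<phi>) + (\<kappa>\<^sup>2 * r\<^sup>2 - n) * (u (rcis r \<phi>) * e \<phi>)))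
          has_integral (up (2*pi) * e (2*pi) - u (rcis r (2*pi)) * e1 (2*pi)) - (up 0 * e 0 - u (rcis r 0) * e1 0)) {0..2*pi}"
        by (rule fundamental_theorem_of_calculus)
          (use d in \<open>auto simp: has_real_derivative_iff_has_vector_derivative intro: has_vector_derivative_at_within\<close>)
      moreover have "(up (2*pi) * e (2*pi) - u (rcis r (2*pi)) * e1 (2*pi)) - (up 0 * e 0 - u (rcis r 0) * e1 0) = 0"
        by (simp add: up_def per rcis_def)
      ultimately have I0: "((\<lambda>\<phi>. - (r\<^sup>2 * (urr r \<phi> * e \<phi>) + r * (ur r \<phi> * e \<phi>) + (\<kappa>\<^sup>2 * r\<^sup>2 - n) * (u (rcis r \<phi>) * e \<phi>)))
          has_integral 0) {0..2*pi}" by simp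
      have I1: "((\<lambda>\<phi>. - (r\<^sup>2 * (urr r \<phi> * e \<phi>) + r * (ur r \<phi> * e \<phi>) + (\<kappa>\<^sup>2 * r\<^sup>2 - n) * (u (rcis r \<phi>) * e \<phi>)))
          has_integral - (r\<^sup>2 * ?P2 r + r * ?P1 r + (\<kappa>\<^sup>2 * r\<^sup>2 - n) * ?P r)) {0..2*pi}"
        by (intro has_integral_neg has_integral_add has_integral_mult_right integrable_integral
            slice[OF c0 r] slice[OF c1 r] slice[OF c2 r])
      show ?thesis using has_integral_unique[OF I0 I1] by linarith
    qed
  qed
qed

section \<open>Completeness of the trigonometric system on a circle\<close>

inductive trig_poly :: "(real \<Rightarrow> complex) \<Rightarrow> bool" where
  base: "trig_poly (\<lambda>\<phi>. c * cis (of_int k * \<phi>))"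
| add: "trig_poly f \<Longrightarrow> trig_poly g \<Longrightarrow> trig_poly (\<lambda>\<phi>. f \<phi> + g \<phi>)"

text \<open>Generators are complex exponentials because the product of two of them is again one;
  sines and cosines would need addition formulas.\<close>

lemma trig_poly_mult:
  assumes "trig_poly f" "trig_poly g"
  shows "trig_poly (\<lambda>\<phi>. f \<phi> * g \<phi>)"
  using assms(1)
proof induction
  case (base c k)
  from assms(2) show ?case
  proof induction
    case (base d l)
    have "(\<lambda>\<phi>. c * cis (of_int k * \<phi>) * (d * cis (of_int l * \<phi>))) = (\<lambda>\<phi>. (c * d) * cis (of_int (k + l) * \<phi>))"
      by (simp add: fun_eq_iff cis_mult[symmetric] ring_distribs)
    then show ?case using trig_poly.base[of "c * d" "k + l"] by simp
  next
    case (add f g)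
    then show ?case using trig_poly.add by (simp add: distrib_left)
  qed
next
  case (add f g)
  then show ?case using trig_poly.add by (simp add: distrib_right)
qed

lemma trig_poly_real_polynomial:
  assumes "real_polynomial_function f"
  shows "trig_poly (\<lambda>\<phi>. of_real (f (rcis r \<phi>)))"
  using assms
proof induction
  case (linear f)
  have "f (rcis r \<phi>) = r * cos \<phi> * f 1 + r * sin \<phi> * f \<i>" for \<phi>
  proof -
    have "rcis r \<phi> = (r * cos \<phi>) *\<^sub>R 1 + (r * sin \<phi>) *\<^sub>R \<i>" by (simp add: complex_eq_iff)
    then have "f (rcis r \<phi>) = (r * cos \<phi>) *\<^sub>R f 1 + (r * sin \<phi>) *\<^sub>R f \<i>"
      using linear by (simp only: linear_add[OF bounded_linear.linear] linear_scale[OF bounded_linear.linear])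
    then show ?thesis by simp
  qed
  \<comment> \<open>Euler's formula: A cos + B sin has the coefficients (A - iB)/2 and (A + iB)/2 at
    the frequencies 1 and -1.\<close>
  then have "(\<lambda>\<phi>. complex_of_real (f (rcis r \<phi>))) =
     (\<lambda>\<phi>. Complex (r * f 1 / 2) (- r * f \<i> / 2) * cis (of_int 1 * \<phi>)
        + Complex (r * f 1 / 2) (r * f \<i> / 2) * cis (of_int (- 1) * \<phi>))"
    by (simp add: fun_eq_iff complex_eq_iff algebra_simps)
  then show ?case by (simp only: trig_poly.add[OF trig_poly.base trig_poly.base])
next
  case (const c)
  then show ?case using trig_poly.base[of "of_real c" 0] by simp
next
  case (add f g)
  then show ?case using trig_poly.add by simp
next
  case (mult f g)
  then show ?case using trig_poly_mult by simp
qed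

text \<open>Polynomials restricted to the circle are trigonometric, so f is orthogonal to them. With
  a Stone-Weierstrass approximant P, the integral of f^2 equals that of f (f - P), which is at most
  \<epsilon> times the integral of |f|.\<close>

lemma Fourier_uniqueness:
  fixes f :: "complex \<Rightarrow> real"
  assumes f: "continuous_on (sphere 0 r) f" and r: "r > 0"
    and cos0: "\<And>k::int. integral {0..2*pi} (\<lambda>\<phi>. f (rcis r \<phi>) * cos (of_int k * \<phi>)) = 0"
    and sin0: "\<And>k::int. integral {0..2*pi} (\<lambda>\<phi>. f (rcis r \<phi>) * sin (of_int k * \<phi>)) = 0"
    and z: "cmod z = r"
  shows "f z = 0"
proof -
  define g where "g \<phi> = f (rcis r \<phi>)" for \<phi>
  have rs: "rcis r \<phi> \<in> sphere 0 r" for \<phi> using r by simp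
  have g: "continuous_on S g" for S
    unfolding g_def
    by (rule continuous_on_compose2[OF f]) (use rs in \<open>auto simp: rcis_def cis_conv_exp intro!: continuous_intros\<close>)
  have trig: "((\<lambda>\<phi>. of_real (g \<phi>) * t \<phi>) has_integral 0) {0..2*pi}" if "trig_poly t" for t
    using that
  proof induction
    case (base c k)
    have "((\<lambda>\<phi>. g \<phi> * cos (of_int k * \<phi>)) has_integral 0) {0..2*pi}"
    proof -
      have "(\<lambda>\<phi>. g \<phi> * cos (of_int k * \<phi>)) integrable_on {0..2*pi}"
        by (intro integrable_continuous_real continuous_intros g)
      from integrable_integral[OF this] show ?thesis using cos0[of k] by (simp add: g_def)
    qed
    moreover have "((\<lambda>\<phi>. g \<phi> * sin (of_int k * \<phi>)) has_integral 0) {0..2*pi}"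
    proof -
      have "(\<lambda>\<phi>. g \<phi> * sin (of_int k * \<phi>)) integrable_on {0..2*pi}"
        by (intro integrable_continuous_real continuous_intros g)
      from integrable_integral[OF this] show ?thesis using sin0[of k] by (simp add: g_def)
    qed
    ultimately have "((\<lambda>\<phi>. c * (of_real (g \<phi> * cos (of_int k * \<phi>)) + \<i> * of_real (g \<phi> * sin (of_int k * \<phi>))))
        has_integral c * (of_real 0 + \<i> * of_real 0)) {0..2*pi}"
      by (intro has_integral_mult_right has_integral_add has_integral_of_real)
    moreover have "(\<lambda>\<phi>. of_real (g \<phi>) * (c * cis (of_int k * \<phi>))) =
        (\<lambda>\<phi>. c * (of_real (g \<phi> * cos (of_int k * \<phi>)) + \<i> * of_real (g \<phi> * sin (of_int k * \<phi>))))"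
    proof
      fix \<phi>
      have "of_real (g \<phi>) * cis (of_int k * \<phi>) =
          of_real (g \<phi> * cos (of_int k * \<phi>)) + \<i> * of_real (g \<phi> * sin (of_int k * \<phi>))"
        by (simp add: complex_eq_iff)
      then show "of_real (g \<phi>) * (c * cis (of_int k * \<phi>)) =
          c * (of_real (g \<phi> * cos (of_int k * \<phi>)) + \<i> * of_real (g \<phi> * sin (of_int k * \<phi>)))"
        by (metis mult.left_commute)
    qed
    ultimately show ?case by (simp only: of_real_0 mult_zero_right add_0_left)
  next
    case (add t s)
    from has_integral_add[OF add.IH] show ?case by (simp add: distrib_left)
  qed
  have poly: "((\<lambda>\<phi>. g \<phi> * P (rcis r \<phi>)) has_integral 0) {0..2*pi}" if "real_polynomial_function P" for P
    using has_integral_Re[OF trig[OF trig_poly_real_polynomial[OF that, of r]]] by simp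
  define M where "M = integral {0..2*pi} (\<lambda>\<phi>. \<bar>g \<phi>\<bar>)"
  have "M \<ge> 0" unfolding M_def by (rule integral_nonneg) (auto intro!: integrable_continuous_real continuous_intros g)
  have int2: "(\<lambda>\<phi>. (g \<phi>)\<^sup>2) integrable_on {0..2*pi}"
    by (intro integrable_continuous_real continuous_intros g)
  have bound: "integral {0..2*pi} (\<lambda>\<phi>. (g \<phi>)\<^sup>2) \<le> \<epsilon> * M" if "\<epsilon> > 0" for \<epsilon>
  proof -
    obtain P where P: "real_polynomial_function P" "\<And>x. x \<in> sphere 0 r \<Longrightarrow> \<bar>f x - P x\<bar> < \<epsilon>"
      using Stone_Weierstrass_real_polynomial_function[OF compact_sphere f \<open>\<epsilon> > 0\<close>] by metis
    have I1: "((\<lambda>\<phi>. (g \<phi>)\<^sup>2 - g \<phi> * P (rcis r \<phi>)) has_integral integral {0..2*pi} (\<lambda>\<phi>. (g \<phi>)\<^sup>2) - 0) {0..2*pi}"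
      by (intro has_integral_diff poly P integrable_integral int2)
    have I2: "((\<lambda>\<phi>. \<epsilon> * \<bar>g \<phi>\<bar>) has_integral \<epsilon> * M) {0..2*pi}"
      unfolding M_def by (intro has_integral_mult_right integrable_integral integrable_continuous_real continuous_intros g)
    have "(g \<phi>)\<^sup>2 - g \<phi> * P (rcis r \<phi>) \<le> \<epsilon> * \<bar>g \<phi>\<bar>" for \<phi>
    proof -
      have "(g \<phi>)\<^sup>2 - g \<phi> * P (rcis r \<phi>) = g \<phi> * (f (rcis r \<phi>) - P (rcis r \<phi>))"
        by (simp add: g_def power2_eq_square algebra_simps)
      also have "\<dots> \<le> \<bar>g \<phi>\<bar> * \<bar>f (rcis r \<phi>) - P (rcis r \<phi>)\<bar>"
        by (metis abs_ge_self abs_mult)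
      also have "\<dots> \<le> \<bar>g \<phi>\<bar> * \<epsilon>"
        using P(2)[OF rs[of \<phi>]] by (intro mult_left_mono) auto
      finally show ?thesis by (simp add: mult.commute)
    qed
    with has_integral_le[OF I1 I2] show ?thesis by simp
  qed
  have "integral {0..2*pi} (\<lambda>\<phi>. (g \<phi>)\<^sup>2) \<le> 0"
  proof (rule field_le_epsilon)
    fix \<epsilon> :: real assume "\<epsilon> > 0"
    \<comment> \<open>Division by \<open>M + 1\<close> instead of \<open>M\<close> also covers the
      case \<open>M = 0\<close>.\<close>
    then have "integral {0..2*pi} (\<lambda>\<phi>. (g \<phi>)\<^sup>2) \<le> \<epsilon> / (M + 1) * M"
      using \<open>M \<ge> 0\<close> by (intro bound) simp
    also have "\<dots> \<le> 0 + \<epsilon>" using \<open>M \<ge> 0\<close> \<open>\<epsilon> > 0\<close> by (simp add: field_simps)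
    finally show "integral {0..2*pi} (\<lambda>\<phi>. (g \<phi>)\<^sup>2) \<le> 0 + \<epsilon>" .
  qed
  moreover have "integral {0..2*pi} (\<lambda>\<phi>. (g \<phi>)\<^sup>2) \<ge> 0"
    by (rule integral_nonneg[OF int2]) simp
  ultimately have "\<forall>\<phi>\<in>{0..2*pi}. (g \<phi>)\<^sup>2 = 0"
    using integral_eq_0_iff[of 0 "2*pi" "\<lambda>\<phi>. (g \<phi>)\<^sup>2"]
    by (auto intro!: continuous_intros g)
  moreover have "z = rcis r (Arg2pi z)" "Arg2pi z \<in> {0..2*pi}"
    using Arg2pi[of z] z by (auto simp: is_Arg_def rcis_def cis_conv_exp)
  ultimately show ?thesis by (metis g_def power_eq_0_iff)
qed

section \<open>Consequences of the radiation condition\<close>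

text \<open>The radial derivative is written through the gradient, so that reflections and rotations
  can be handled algebraically. Uniformity in the direction is built in, since \<open>R\<close>
  depends on \<epsilon> alone.\<close>

definition radiating ::
    "real \<Rightarrow> (complex \<Rightarrow> complex) \<Rightarrow> (complex \<Rightarrow> complex) \<Rightarrow> (complex \<Rightarrow> complex) \<Rightarrow> bool" where
  "radiating \<kappa> u p q \<longleftrightarrow> (\<forall>\<epsilon>>0. \<exists>R. \<forall>z. cmod z > R \<longrightarrow>
     cmod ((Re z / cmod z) *\<^sub>R p z + (Im z / cmod z) *\<^sub>R q z - \<i> * of_real \<kappa> * u z) * sqrt (cmod z) \<le> \<epsilon>)"

text \<open>Along a ray, exp(-i \<kappa> s) u has the derivative exp(-i \<kappa> s) (u_r - i
  \<kappa> u), of size o(1/sqrt s), and integration gives o(sqrt r). This weak bound is enough: it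
  is applied to terms that have one power of r less than the leading one.\<close>

lemma radiating_growth:
  assumes rad: "radiating \<kappa> u p q" and u: "has_grad D u p q"
    and R0: "R0 \<ge> 0" "\<And>z. cmod z > R0 \<Longrightarrow> z \<in> D" and \<epsilon>: "\<epsilon> > 0"
  shows "\<exists>R. \<forall>z. cmod z > R \<longrightarrow> cmod (u z) \<le> \<epsilon> * sqrt (cmod z)"
proof -
  \<comment> \<open>Integrating \<delta>/sqrt s costs 2 \<delta> sqrt r, and the values on the
    initial circle are absorbed by another 2 \<delta> sqrt r as soon as r exceeds (M / (2
    \<delta>))^2.\<close>
  define \<delta> where "\<delta> = \<epsilon> / 4"
  have "\<delta> > 0" using \<epsilon> by (simp add: \<delta>_def)
  then obtain R1 where R1: "\<And>z. cmod z > R1 \<Longrightarrow>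
     cmod ((Re z / cmod z) *\<^sub>R p z + (Im z / cmod z) *\<^sub>R q z - \<i> * of_real \<kappa> * u z) * sqrt (cmod z) \<le> \<delta>"
    using rad unfolding radiating_def by meson
  define a where "a = max R0 R1 + 1"
  have a: "a > R0" "a > R1" "a > 0" using R0(1) by (auto simp: a_def)
  have "continuous_on (sphere 0 a) u"
    by (rule continuous_on_subset[OF has_grad_continuous_on[OF u]]) (use a R0 in auto)
  then have "bounded (u ` sphere 0 a)"
    by (intro compact_imp_bounded compact_continuous_image compact_sphere)
  then obtain M where "\<forall>w\<in>u ` sphere 0 a. cmod w \<le> M"
    unfolding bounded_iff by blast
  then have M: "cmod (u z) \<le> M" if "cmod z = a" for z using that by simp
  have "cmod (u z) \<le> \<epsilon> * sqrt (cmod z)" if z: "cmod z > max a ((M / (2 * \<delta>))\<^sup>2)" for z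
  proof -
    define r where "r = cmod z"
    define \<phi> where "\<phi> = Arg z"
    define f where "f s = cis (- \<kappa> * s) * u (rcis s \<phi>)" for s
    define f1 where "f1 s = cis (- \<kappa> * s) *
      (cos \<phi> *\<^sub>R p (rcis s \<phi>) + sin \<phi> *\<^sub>R q (rcis s \<phi>) - \<i> * of_real \<kappa> * u (rcis s \<phi>))" for s
    have r: "r > a" "r > (M / (2 * \<delta>))\<^sup>2" using z by (auto simp: r_def)
    have df: "(f has_vector_derivative f1 s) (at s)" if s: "s \<ge> a" for s
    proof -
      have "rcis s \<phi> \<in> D" using s a R0 by auto
      from has_grad_chain[where \<gamma> = "\<lambda>s. rcis s \<phi>", OF u rcis_radial_derivative this]
      have du: "((\<lambda>s. u (rcis s \<phi>)) has_vector_derivative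
          cos \<phi> *\<^sub>R p (rcis s \<phi>) + sin \<phi> *\<^sub>R q (rcis s \<phi>)) (at s)" by simp
      have "((\<lambda>s. - \<kappa> * s) has_derivative (\<lambda>h. - \<kappa> * h)) (at s)"
        by (auto intro!: derivative_eq_intros)
      from has_derivative_cis[OF this]
      have "((\<lambda>s. cis (- \<kappa> * s)) has_vector_derivative - \<i> * of_real \<kappa> * cis (- \<kappa> * s)) (at s)"
        unfolding has_vector_derivative_def by (simp add: scaleR_conv_of_real mult_ac)
      from has_vector_derivative_mult[OF this du]
      show ?thesis unfolding f_def f1_def by (simp add: algebra_simps)
    qed
    have "norm (f r - f a) \<le> 2 * \<delta> * sqrt r - 2 * \<delta> * sqrt a"
    proof (rule differentiable_bound_general[OF \<open>r > a\<close>])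
      show "continuous_on {a..r} f"
        using df by (meson atLeastAtMost_iff continuous_at_imp_continuous_on has_vector_derivative_continuous)
      show "continuous_on {a..r} (\<lambda>s. 2 * \<delta> * sqrt s)" by (intro continuous_intros)
      show "(f has_vector_derivative f1 s) (at s)" if "a < s" for s using df that by simp
      show "((\<lambda>s. 2 * \<delta> * sqrt s) has_vector_derivative \<delta> / sqrt s) (at s)" if "a < s" for s
        using a(3) that unfolding has_real_derivative_iff_has_vector_derivative[symmetric]
        by (auto intro!: derivative_eq_intros simp: field_simps)
      show "norm (f1 s) \<le> \<delta> / sqrt s" if "a < s" for s
      proof -
        have "norm (f1 s) = cmod (cos \<phi> *\<^sub>R p (rcis s \<phi>) + sin \<phi> *\<^sub>R q (rcis s \<phi>)
            - \<i> * of_real \<kappa> * u (rcis s \<phi>))"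
          unfolding f1_def norm_mult by simp
        moreover have "\<dots> * sqrt s \<le> \<delta>" using R1[of "rcis s \<phi>"] a that by simp
        ultimately show ?thesis using a that by (simp add: pos_le_divide_eq)
      qed
    qed
    moreover have "norm (f r) = cmod (u z)"
      by (simp add: f_def norm_mult r_def \<phi>_def rcis_cmod_Arg)
    moreover have "norm (f a) \<le> M" using M[of "rcis a \<phi>"] a by (simp add: f_def norm_mult)
    moreover have "M \<le> 2 * \<delta> * sqrt r"
    proof -
      have "M / (2 * \<delta>) \<le> sqrt r" by (rule real_le_rsqrt[OF less_imp_le[OF r(2)]])
      then show ?thesis using \<open>\<delta> > 0\<close> by (simp add: field_simps)
    qed
    moreover have "2 * \<delta> * sqrt a \<ge> 0" using \<open>\<delta> > 0\<close> a by simp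
    moreover have "norm (f r) \<le> norm (f r - f a) + norm (f a)"
      by (metis norm_triangle_sub add.commute)
    ultimately have "cmod (u z) \<le> 4 * \<delta> * sqrt r" by linarith
    then show ?thesis by (simp add: r_def \<delta>_def)
  qed
  then show ?thesis by blast
qed

section \<open>Reflection in the line and the even part\<close>

definition mirror :: "real \<Rightarrow> complex \<Rightarrow> complex" where
  "mirror b z = Complex (Re z) (2 * b - Im z)"

lemma mirror_simps [simp]:
  "Re (mirror b z) = Re z" "Im (mirror b z) = 2 * b - Im z"
  by (simp_all add: mirror_def)

text \<open>The reflection moves the centre of the radiation condition by a bounded amount, so radii
  at mirror points may be exchanged at the cost of lower order terms.\<close>

lemma cmod_mirror: "\<bar>cmod z - cmod (mirror b z)\<bar> \<le> 2 * \<bar>b\<bar>"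
proof -
  have "mirror b z = cnj z + of_real (2 * b) * \<i>" by (simp add: complex_eq_iff)
  then have "\<bar>cmod (mirror b z) - cmod (cnj z)\<bar> \<le> cmod (of_real (2 * b) * \<i>)"
    by (metis add_diff_cancel_left' norm_triangle_ineq3)
  then show ?thesis by (simp add: norm_mult abs_minus_commute)
qed

lemma helmholtz_on_mirror:
  assumes "helmholtz_on \<kappa> D u p q"
  shows "helmholtz_on \<kappa> {z. mirror b z \<in> D} (\<lambda>z. u (mirror b z)) (\<lambda>z. p (mirror b z)) (\<lambda>z. - q (mirror b z))"
proof -
  have "2 * \<i> * of_real b + 1 * cnj z = mirror b z" for z by (simp add: complex_eq_iff)
  with helmholtz_on_cnj[OF helmholtz_on_rigid[OF assms, of 1 "2 * \<i> * of_real b"]]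
  show ?thesis by simp
qed

text \<open>Lets an identity that holds on an open set, such as oddness, be differentiated for given
  partials.\<close>

lemma has_grad_zero_on_open:
  assumes "has_grad D u p q" "open S" "S \<subseteq> D" "z \<in> S" "\<And>w. w \<in> S \<Longrightarrow> u w = 0"
  shows "p z = 0" "q z = 0"
proof -
  have "(u has_derivative (\<lambda>h. Re h *\<^sub>R p z + Im h *\<^sub>R q z)) (at z)"
    using assms unfolding has_grad_def by auto
  moreover have "(u has_derivative (\<lambda>h. 0)) (at z)"
    by (rule has_derivative_transform_within_open[OF has_derivative_const assms(2,4)]) (use assms(5) in auto)
  ultimately have "(\<lambda>h. Re h *\<^sub>R p z + Im h *\<^sub>R q z) = (\<lambda>h. 0)" by (rule has_derivative_unique)
  from fun_cong[OF this, of 1] fun_cong[OF this, of \<i>]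
  show "p z = 0" "q z = 0" by simp_all
qed

text \<open>If \<open>Im u\<close> is odd about the line \<open>Im z = b\<close>, then differentiating this symmetry and inserting the
  radiation condition at \<open>z\<close> and at its mirror image shows that \<open>Re u\<close> is odd up to lower order terms and
  one tangential derivative.\<close>

lemma even_part_asymptotics:
  assumes \<kappa>: "\<kappa> > 0" and rad: "radiating \<kappa> u p q" and u: "has_grad D u p q"
    and R0: "R0 \<ge> 0" "\<And>z. cmod z > R0 \<Longrightarrow> z \<in> D"
    and odd: "\<And>z. cmod z > R0 \<Longrightarrow> Im (u z) + Im (u (mirror b z)) = 0" and \<epsilon>: "\<epsilon> > 0"
  shows "\<exists>R. \<forall>r>R. \<forall>\<phi>. \<bar>\<kappa> * r * (Re (u (rcis r \<phi>)) + Re (u (mirror b (rcis r \<phi>))))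
     - 2 * b / r * (cos \<phi> * (r * (- sin \<phi> * Im (p (rcis r \<phi>)) + cos \<phi> * Im (q (rcis r \<phi>)))))\<bar> \<le> \<epsilon> * sqrt r"
proof -
  \<comment> \<open>The sum of the coefficients of \<delta> sqrt r in the final estimate: 4 \<kappa>
    |b| from the difference of radii, 3 from the two defects, 2 \<kappa> |b| + 2 |b| from the radial
    derivative.\<close>
  define C where "C = 6 * \<kappa> * \<bar>b\<bar> + 2 * \<bar>b\<bar> + 3"
  have "C > 0" using \<kappa> by (simp add: C_def add_nonneg_pos)
  define \<delta> where "\<delta> = \<epsilon> / C"
  have \<delta>: "\<delta> > 0" using \<epsilon> \<open>C > 0\<close> by (simp add: \<delta>_def)
  obtain R1 where R1: "\<And>z. cmod z > R1 \<Longrightarrow>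
     cmod ((Re z / cmod z) *\<^sub>R p z + (Im z / cmod z) *\<^sub>R q z - \<i> * of_real \<kappa> * u z) * sqrt (cmod z) \<le> \<delta>"
    using rad \<delta> unfolding radiating_def by meson
  obtain R2 where R2: "\<And>z. cmod z > R2 \<Longrightarrow> cmod (u z) \<le> \<delta> * sqrt (cmod z)"
    using radiating_growth[OF rad u R0 \<delta>] by blast
  \<comment> \<open>The imaginary part of the radiation defect: radial derivative of
    \<open>Im u\<close> minus \<kappa> \<open>Re u\<close>.\<close>
  define E where "E z = (Re z * Im (p z) + Im z * Im (q z)) / cmod z - \<kappa> * Re (u z)" for z
  have E: "\<bar>E z\<bar> * sqrt (cmod z) \<le> \<delta>" if "cmod z > R1" for z
  proof -
    have "E z = Im ((Re z / cmod z) *\<^sub>R p z + (Im z / cmod z) *\<^sub>R q z - \<i> * of_real \<kappa> * u z)"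
      by (simp add: E_def add_divide_distrib)
    then have "\<bar>E z\<bar> * sqrt (cmod z) \<le>
        cmod ((Re z / cmod z) *\<^sub>R p z + (Im z / cmod z) *\<^sub>R q z - \<i> * of_real \<kappa> * u z) * sqrt (cmod z)"
      by (intro mult_right_mono) (metis abs_Im_le_cmod, simp)
    with R1[OF that] show ?thesis by simp
  qed
  \<comment> \<open>The margin 2 |b| keeps the mirror point outside all three discs as well; the
    extra 1 ensures r \<ge> 1.\<close>
  define R where "R = max R0 (max R1 R2) + 2 * \<bar>b\<bar> + 1"
  have "\<bar>\<kappa> * r * (Re (u (rcis r \<phi>)) + Re (u (mirror b (rcis r \<phi>))))
     - 2 * b / r * (cos \<phi> * (r * (- sin \<phi> * Im (p (rcis r \<phi>)) + cos \<phi> * Im (q (rcis r \<phi>)))))\<bar> \<le> \<epsilon> * sqrt r"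
    if r: "r > R" for r \<phi>
  proof -
    define z where "z = rcis r \<phi>"
    define \<zeta> where "\<zeta> = mirror b z"
    have r1: "r \<ge> 1" "r \<ge> 2 * \<bar>b\<bar>" using r R0(1) by (auto simp: R_def)
    have z: "cmod z = r" using r1 by (simp add: z_def)
    have \<zeta>r: "\<bar>r - cmod \<zeta>\<bar> \<le> 2 * \<bar>b\<bar>" using cmod_mirror[of z b] by (simp add: z \<zeta>_def)
    have big: "cmod z > R0" "cmod z > R1" "cmod z > R2" "cmod \<zeta> > R0" "cmod \<zeta> > R1" "cmod \<zeta> > R2"
      using r \<zeta>r by (auto simp: R_def z)
    have "cmod \<zeta> > 0" using big R0 by linarith
    have "cmod \<zeta> \<le> 2 * r" using \<zeta>r r1 by linarith
    then have "sqrt (cmod \<zeta>) \<le> sqrt (2\<^sup>2 * r)" using r1 by (intro real_sqrt_le_mono) simp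
    then have s\<zeta>: "sqrt (cmod \<zeta>) \<le> 2 * sqrt r" by (simp add: real_sqrt_mult)
    have grad: "Im (p z) + Im (p \<zeta>) = 0" "Im (q z) + - Im (q \<zeta>) = 0"
    proof -
      let ?S = "{z. cmod z > R0} \<inter> {z. cmod (mirror b z) > R0}"
      have mc: "continuous_on UNIV (mirror b)" unfolding mirror_def by (intro continuous_intros)
      have S: "open ?S"
        by (intro open_Int open_Collect_less continuous_intros mc)
      have m2: "mirror b w = 2 * \<i> * of_real b + 1 * cnj w" for w by (simp add: complex_eq_iff)
      have gm: "has_grad {z. mirror b z \<in> D} (\<lambda>z. u (mirror b z)) (\<lambda>z. p (mirror b z)) (\<lambda>z. - q (mirror b z))"
        unfolding m2 using has_grad_cnj[OF has_grad_rigid[OF u, of "2 * \<i> * of_real b" 1]] by simp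
      have "has_grad ?S (\<lambda>z. Im (u z) + Im (u (mirror b z))) (\<lambda>z. Im (p z) + Im (p (mirror b z)))
          (\<lambda>z. Im (q z) + Im (- q (mirror b z)))"
        by (intro has_grad_add has_grad_bounded_linear[OF bounded_linear_Im]
            has_grad_subset[OF u] has_grad_subset[OF gm]) (use R0 in auto)
      from has_grad_zero_on_open[OF this S subset_refl, of z] odd big
      show "Im (p z) + Im (p \<zeta>) = 0" "Im (q z) + - Im (q \<zeta>) = 0" by (auto simp: \<zeta>_def)
    qed
    have pz: "Im (p \<zeta>) = - Im (p z)" "Im (q \<zeta>) = Im (q z)" using grad by simp_all
    have zc: "Re z = r * cos \<phi>" "Im z = r * sin \<phi>" by (simp_all add: z_def)
    have V1: "\<kappa> * Re (u z) + E z = cos \<phi> * Im (p z) + sin \<phi> * Im (q z)"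
      using r1 by (simp add: E_def z zc field_simps)
    have V2: "cmod \<zeta> * (\<kappa> * Re (u \<zeta>) + E \<zeta>) = - (r * cos \<phi>) * Im (p z) + (2 * b - r * sin \<phi>) * Im (q z)"
      using \<open>cmod \<zeta> > 0\<close> by (simp add: E_def pz) (simp add: \<zeta>_def zc)
    \<comment> \<open>Adding r times the condition at \<open>z\<close> and |\<zeta>| times the one
      at \<zeta> cancels the gradient of \<open>Im u\<close> except for 2 b Im q. Since Im q is sin
      \<phi> times the radial derivative plus cos \<phi> / r times the angular one, its radial share
      returns to \<kappa> Re u + E and only the angular share is left on the left side.\<close>
    have "\<kappa> * r * (Re (u z) + Re (u \<zeta>)) - 2 * b / r * (cos \<phi> * (r * (- sin \<phi> * Im (p z) + cos \<phi> * Im (q z))))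
        = \<kappa> * (r - cmod \<zeta>) * Re (u \<zeta>) - r * E z - cmod \<zeta> * E \<zeta> + 2 * b * sin \<phi> * (\<kappa> * Re (u z) + E z)"
    proof -
      have cs: "cos \<phi> * cos \<phi> = 1 - sin \<phi> * sin \<phi>"
        using sin_cos_squared_add[of \<phi>] by (simp add: power2_eq_square)
      have 1: "2 * b / r * (cos \<phi> * (r * (- sin \<phi> * Im (p z) + cos \<phi> * Im (q z)))) =
          2 * b * (- sin \<phi> * cos \<phi> * Im (p z) + (cos \<phi> * cos \<phi>) * Im (q z))"
        using r1 by (simp add: field_simps)
      have 2: "\<kappa> * r * Re (u z) = r * (cos \<phi> * Im (p z) + sin \<phi> * Im (q z)) - r * E z"
        unfolding V1[symmetric] by (simp add: algebra_simps)
      have 3: "\<kappa> * cmod \<zeta> * Re (u \<zeta>) = - (r * cos \<phi>) * Im (p z) + (2 * b - r * sin \<phi>) * Im (q z) - cmod \<zeta> * E \<zeta>"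
        unfolding V2[symmetric] by (simp add: algebra_simps)
      have "\<kappa> * r * (Re (u z) + Re (u \<zeta>)) = \<kappa> * r * Re (u z) + \<kappa> * (r - cmod \<zeta>) * Re (u \<zeta>) + \<kappa> * cmod \<zeta> * Re (u \<zeta>)"
        by (simp add: algebra_simps)
      then show ?thesis unfolding 1 cs V1 unfolding 2 3 by (simp add: algebra_simps)
    qed
    also have "\<bar>\<dots>\<bar> \<le> \<kappa> * (2 * \<bar>b\<bar>) * (\<delta> * (2 * sqrt r)) + \<delta> * sqrt r + \<delta> * (2 * sqrt r)
        + 2 * \<bar>b\<bar> * (\<kappa> * (\<delta> * sqrt r) + \<delta> * sqrt r)"
    proof -
      have u\<zeta>: "\<bar>Re (u \<zeta>)\<bar> \<le> \<delta> * (2 * sqrt r)"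
        using abs_Re_le_cmod[of "u \<zeta>"] R2[OF big(6)] mult_left_mono[OF s\<zeta>, of \<delta>] \<delta> by linarith
      have uz: "\<bar>Re (u z)\<bar> \<le> \<delta> * sqrt r"
        using abs_Re_le_cmod[of "u z"] R2[OF big(3)] by (simp add: z)
      have x: "y * \<bar>E w\<bar> \<le> \<delta> * sqrt y" if "cmod w > R1" "cmod w = y" for w y
      proof -
        have "y \<ge> 0" using that by (metis norm_ge_zero)
        then have "y * \<bar>E w\<bar> = (\<bar>E w\<bar> * sqrt y) * sqrt y" by simp
        also have "\<dots> \<le> \<delta> * sqrt y" using E[OF that(1)] that \<open>y \<ge> 0\<close> by (intro mult_right_mono) auto
        finally show ?thesis .
      qed
      have Ez: "r * \<bar>E z\<bar> \<le> \<delta> * sqrt r" using x[OF big(2) z] .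
      have E\<zeta>: "cmod \<zeta> * \<bar>E \<zeta>\<bar> \<le> \<delta> * (2 * sqrt r)"
        using x[OF big(5) refl] mult_left_mono[OF s\<zeta>, of \<delta>] \<delta> by linarith
      have "1 * \<bar>E z\<bar> \<le> r * \<bar>E z\<bar>" using r1 by (intro mult_right_mono) auto
      with Ez have Ez1: "\<bar>E z\<bar> \<le> \<delta> * sqrt r" by linarith
      have t1: "\<bar>\<kappa> * (r - cmod \<zeta>) * Re (u \<zeta>)\<bar> \<le> \<kappa> * (2 * \<bar>b\<bar>) * (\<delta> * (2 * sqrt r))"
        unfolding abs_mult using \<zeta>r u\<zeta> \<kappa> by (intro mult_mono) auto
      have t2: "\<bar>r * E z\<bar> \<le> \<delta> * sqrt r" using Ez r1 by (simp add: abs_mult)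
      have t3: "\<bar>cmod \<zeta> * E \<zeta>\<bar> \<le> \<delta> * (2 * sqrt r)" using E\<zeta> by (simp add: abs_mult)
      have "\<bar>\<kappa> * Re (u z) + E z\<bar> \<le> \<kappa> * \<bar>Re (u z)\<bar> + \<bar>E z\<bar>"
        using abs_triangle_ineq[of "\<kappa> * Re (u z)" "E z"] \<kappa> by (simp add: abs_mult)
      also have "\<dots> \<le> \<kappa> * (\<delta> * sqrt r) + \<delta> * sqrt r"
        using uz Ez1 \<kappa> by (intro add_mono mult_left_mono) auto
      finally have "\<bar>2 * b * sin \<phi> * (\<kappa> * Re (u z) + E z)\<bar> \<le> 2 * \<bar>b\<bar> * 1 * (\<kappa> * (\<delta> * sqrt r) + \<delta> * sqrt r)"
        unfolding abs_mult by (intro mult_mono) auto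
      then show ?thesis using t1 t2 t3 by linarith
    qed
    also have "\<dots> = \<delta> * C * sqrt r" by (simp add: C_def algebra_simps)
    also have "\<dots> = \<epsilon> * sqrt r" using \<open>C > 0\<close> by (simp add: \<delta>_def)
    finally show ?thesis unfolding z_def \<zeta>_def .
  qed
  then show ?thesis by blast
qed

text \<open>The remaining angular derivative of \<open>Im u\<close> has no pointwise bound, but
  against a mode it falls on cos \<phi> times \<open>e\<close>, leaving \<open>Im u\<close> itself,
  which is o(sqrt r). Dividing o(sqrt r) by \<kappa> r gives o(1/sqrt r).\<close>

lemma even_part_mode_decay:
  fixes e e1 :: "real \<Rightarrow> real"
  assumes \<kappa>: "\<kappa> > 0" and rad: "radiating \<kappa> u p q" and u: "has_grad D u p q"
    and R0: "R0 \<ge> 0" "\<And>z. cmod z > R0 \<Longrightarrow> z \<in> D"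
    and odd: "\<And>z. cmod z > R0 \<Longrightarrow> Im (u z) + Im (u (mirror b z)) = 0"
    and e: "\<And>\<phi>. (e has_real_derivative e1 \<phi>) (at \<phi>)" "\<And>\<phi>. \<bar>e \<phi>\<bar> \<le> 1" "\<And>\<phi>. \<bar>e1 \<phi>\<bar> \<le> K"
    and per: "e (2 * pi) = e 0"
  shows "((\<lambda>r. sqrt r * integral {0..2*pi} (\<lambda>\<phi>. (Re (u (rcis r \<phi>)) + Re (u (mirror b (rcis r \<phi>)))) * e \<phi>)) \<longlongrightarrow> 0) at_top"
proof (rule tendstoI)
  fix \<eta> :: real assume "\<eta> > 0"
  \<comment> \<open>Length 2 pi of the interval times the pointwise bound proved in
    \<open>H\<close>, divided by the leading factor \<kappa>.\<close>
  define C where "C = 2 * pi * (1 + 2 * \<bar>b\<bar> * (K + 1)) / \<kappa>"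
  have "K \<ge> 0" using e(3)[of 0] by linarith
  then have "C > 0" using \<kappa> by (simp add: C_def add_pos_nonneg)
  define \<epsilon> where "\<epsilon> = \<eta> / (2 * C)"
  have \<epsilon>: "\<epsilon> > 0" using \<open>\<eta> > 0\<close> \<open>C > 0\<close> by (simp add: \<epsilon>_def)
  obtain R1 where R1: "\<And>r \<phi>. r > R1 \<Longrightarrow> \<bar>\<kappa> * r * (Re (u (rcis r \<phi>)) + Re (u (mirror b (rcis r \<phi>))))
     - 2 * b / r * (cos \<phi> * (r * (- sin \<phi> * Im (p (rcis r \<phi>)) + cos \<phi> * Im (q (rcis r \<phi>)))))\<bar> \<le> \<epsilon> * sqrt r"
    using even_part_asymptotics[OF \<kappa> rad u R0 odd \<epsilon>] by blast
  obtain R2 where R2: "\<And>z. cmod z > R2 \<Longrightarrow> cmod (u z) \<le> \<epsilon> * sqrt (cmod z)"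
    using radiating_growth[OF rad u R0 \<epsilon>] by blast
  define R where "R = max R0 (max R1 R2) + 2 * \<bar>b\<bar> + 1"
  have "\<bar>sqrt r * integral {0..2*pi} (\<lambda>\<phi>. (Re (u (rcis r \<phi>)) + Re (u (mirror b (rcis r \<phi>)))) * e \<phi>)\<bar> < \<eta>"
    if r: "r > R" for r
  proof -
    define Q where "Q \<phi> = Re (u (rcis r \<phi>)) + Re (u (mirror b (rcis r \<phi>)))" for \<phi>
    define V where "V \<phi> = Im (u (rcis r \<phi>))" for \<phi>
    define V1 where "V1 \<phi> = r * (- sin \<phi> * Im (p (rcis r \<phi>)) + cos \<phi> * Im (q (rcis r \<phi>)))" for \<phi>
    have r1: "r \<ge> 1" "r > R0" "r > R1" "r > R2" using r R0(1) by (auto simp: R_def)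
    have zD: "rcis r \<phi> \<in> D" "mirror b (rcis r \<phi>) \<in> D" for \<phi>
    proof -
      show "rcis r \<phi> \<in> D" using r1 by (intro R0(2)) simp
      show "mirror b (rcis r \<phi>) \<in> D"
        using cmod_mirror[of "rcis r \<phi>" b] r R0(1) by (intro R0(2)) (auto simp: R_def)
    qed
    have rc: "continuous_on S (rcis r)" for S
      unfolding rcis_def cis_conv_exp by (intro continuous_intros)
    have mrc: "continuous_on S (\<lambda>\<phi>. mirror b (rcis r \<phi>))" for S
      unfolding mirror_def by (intro continuous_intros rc)
    have uc: "continuous_on D u" using u by (rule has_grad_continuous_on)
    have ec: "continuous_on S e" for S
      using e(1) by (meson DERIV_continuous continuous_at_imp_continuous_on)
    have "continuous_on {0..2*pi} (\<lambda>\<phi>. Q \<phi> * e \<phi>)"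
      unfolding Q_def
      by (intro continuous_intros ec continuous_on_compose2[OF uc rc] continuous_on_compose2[OF uc mrc])
        (use zD in auto)
    then have QI: "((\<lambda>\<phi>. Q \<phi> * e \<phi>) has_integral integral {0..2*pi} (\<lambda>\<phi>. Q \<phi> * e \<phi>)) {0..2*pi}"
      by (intro integrable_integral integrable_continuous_real)
    have dV: "(V has_real_derivative V1 \<phi>) (at \<phi>)" for \<phi>
      using has_grad_chain[where \<gamma> = "rcis r", OF has_grad_bounded_linear[OF bounded_linear_Im u] rcis_angular_derivative zD(1)]
      by (simp add: V_def[abs_def] V1_def has_real_derivative_iff_has_vector_derivative algebra_simps)
    have dce: "((\<lambda>\<phi>. cos \<phi> * e \<phi>) has_real_derivative (- sin \<phi> * e \<phi> + e1 \<phi> * cos \<phi>)) (at \<phi>)" for \<phi>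
      by (rule DERIV_mult[OF DERIV_cos e(1)])
    \<comment> \<open>The derivative of cos \<phi> e V, which integrates to 0 over a period.
      Subtracting a multiple of it replaces the angular derivative \<open>V1\<close> by
      \<open>V\<close> without changing the integral.\<close>
    define B where "B \<phi> = (- sin \<phi> * e \<phi> + e1 \<phi> * cos \<phi>) * V \<phi> + V1 \<phi> * (cos \<phi> * e \<phi>)" for \<phi>
    have "(B has_integral (cos (2*pi) * e (2*pi) * V (2*pi) - cos 0 * e 0 * V 0)) {0..2*pi}"
      unfolding B_def
      by (rule fundamental_theorem_of_calculus)
        (use DERIV_mult[OF dce dV] in \<open>auto simp: has_real_derivative_iff_has_vector_derivative
          intro: has_vector_derivative_at_within\<close>)
    then have "(B has_integral 0) {0..2*pi}" by (simp add: per V_def rcis_def)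
    from has_integral_diff[OF has_integral_mult_right[OF QI, of "\<kappa> * r"] has_integral_mult_right[OF this, of "2 * b / r"]]
    have HI: "((\<lambda>\<phi>. \<kappa> * r * (Q \<phi> * e \<phi>) - 2 * b / r * B \<phi>) has_integral
        \<kappa> * r * integral {0..2*pi} (\<lambda>\<phi>. Q \<phi> * e \<phi>)) (cbox 0 (2*pi))" by simp
    have H: "norm (\<kappa> * r * (Q \<phi> * e \<phi>) - 2 * b / r * B \<phi>) \<le> \<epsilon> * sqrt r * (1 + 2 * \<bar>b\<bar> * (K + 1))" for \<phi>
    proof -
      have "\<kappa> * r * (Q \<phi> * e \<phi>) - 2 * b / r * B \<phi> = (\<kappa> * r * Q \<phi> - 2 * b / r * (cos \<phi> * V1 \<phi>)) * e \<phi>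
          - 2 * b / r * (- sin \<phi> * e \<phi> + e1 \<phi> * cos \<phi>) * V \<phi>"
        by (simp add: B_def algebra_simps)
      also have "\<bar>\<dots>\<bar> \<le> \<bar>(\<kappa> * r * Q \<phi> - 2 * b / r * (cos \<phi> * V1 \<phi>)) * e \<phi>\<bar>
          + \<bar>2 * b / r * (- sin \<phi> * e \<phi> + e1 \<phi> * cos \<phi>) * V \<phi>\<bar>"
        by (rule abs_triangle_ineq4)
      also have "\<bar>(\<kappa> * r * Q \<phi> - 2 * b / r * (cos \<phi> * V1 \<phi>)) * e \<phi>\<bar> \<le> (\<epsilon> * sqrt r) * 1"
        unfolding abs_mult[of _ "e \<phi>"] Q_def V1_def
        using R1[OF r1(3)] e(2) r1 \<epsilon> by (intro mult_mono) auto
      also have "\<bar>2 * b / r * (- sin \<phi> * e \<phi> + e1 \<phi> * cos \<phi>) * V \<phi>\<bar> \<le> 2 * \<bar>b\<bar> * (K + 1) * (\<epsilon> * sqrt r)"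
      proof -
        have "\<bar>2 * b / r\<bar> \<le> 2 * \<bar>b\<bar>" using r1(1) mult_right_mono[of 1 r "2 * \<bar>b\<bar>"]
          by (simp add: field_simps)
        moreover have "\<bar>- sin \<phi> * e \<phi> + e1 \<phi> * cos \<phi>\<bar> \<le> K + 1"
        proof -
          have "\<bar>- sin \<phi> * e \<phi>\<bar> \<le> 1 * 1"
            unfolding abs_mult using e(2) by (intro mult_mono) auto
          moreover have "\<bar>e1 \<phi> * cos \<phi>\<bar> \<le> K * 1"
            unfolding abs_mult using e(3) \<open>K \<ge> 0\<close> by (intro mult_mono) auto
          ultimately show ?thesis by linarith
        qed
        moreover have "\<bar>V \<phi>\<bar> \<le> \<epsilon> * sqrt r"
          using abs_Im_le_cmod[of "u (rcis r \<phi>)"] R2[of "rcis r \<phi>"] r1 by (simp add: V_def)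
        ultimately show ?thesis unfolding abs_mult using \<open>K \<ge> 0\<close> \<epsilon> r1 by (intro mult_mono) auto
      qed
      finally show ?thesis by (simp add: algebra_simps)
    qed
    have "norm (\<kappa> * r * integral {0..2*pi} (\<lambda>\<phi>. Q \<phi> * e \<phi>)) \<le>
        \<epsilon> * sqrt r * (1 + 2 * \<bar>b\<bar> * (K + 1)) * measure lborel (cbox 0 (2*pi :: real))"
      by (rule has_integral_bound[OF _ HI]) (use H \<epsilon> r1 \<open>K \<ge> 0\<close> in auto)
    then have "\<kappa> * r * \<bar>integral {0..2*pi} (\<lambda>\<phi>. Q \<phi> * e \<phi>)\<bar> \<le> \<epsilon> * sqrt r * (1 + 2 * \<bar>b\<bar> * (K + 1)) * (2 * pi)"
      using \<kappa> r1 by (simp add: abs_mult)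
    also have "\<dots> = sqrt r * \<kappa> * (\<epsilon> * C)" using \<kappa> by (simp add: C_def)
    finally have *: "\<kappa> * r * \<bar>integral {0..2*pi} (\<lambda>\<phi>. Q \<phi> * e \<phi>)\<bar> \<le> sqrt r * \<kappa> * (\<epsilon> * C)" .
    have "sqrt r * \<kappa> * (sqrt r * \<bar>integral {0..2*pi} (\<lambda>\<phi>. Q \<phi> * e \<phi>)\<bar>) \<le> sqrt r * \<kappa> * (\<epsilon> * C)"
    proof -
      have "sqrt r * sqrt r = r" using r1 by simp
      then have "sqrt r * \<kappa> * (sqrt r * x) = \<kappa> * r * x" for x
        by (metis mult.assoc mult.commute)
      then show ?thesis using * by (simp only:)
    qed
    then have "sqrt r * \<bar>integral {0..2*pi} (\<lambda>\<phi>. Q \<phi> * e \<phi>)\<bar> \<le> \<epsilon> * C"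
      using \<kappa> r1 by (simp add: mult_le_cancel_left)
    also have "\<epsilon> * C < \<eta>" using \<open>\<eta> > 0\<close> \<open>C > 0\<close> by (simp add: \<epsilon>_def)
    finally show ?thesis using r1 by (simp add: abs_mult Q_def)
  qed
  then show "\<forall>\<^sub>F r in at_top. dist (sqrt r * integral {0..2*pi}
      (\<lambda>\<phi>. (Re (u (rcis r \<phi>)) + Re (u (mirror b (rcis r \<phi>)))) * e \<phi>)) 0 < \<eta>"
    by (auto intro!: eventually_mono[OF eventually_gt_at_top[of R]])
qed

section \<open>From data on the line to vanishing on the line\<close>

lemma helmholtz_line_uniqueness:
  fixes u :: "complex \<Rightarrow> complex"
  assumes u: "helmholtz_on \<kappa> D u p q" and line: "\<And>t. Complex t b \<in> D"
    and J: "open J" "J \<noteq> {}" "\<And>t. t \<in> J \<Longrightarrow> u (Complex t b) = 0"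
  shows "u (Complex t b) = 0"
proof -
  have e: "\<i> * of_real b + 1 * of_real t = Complex t b" for t by (simp add: complex_eq_iff)
  show ?thesis
    using helmholtz_real_axis_uniqueness[OF helmholtz_on_rigid[OF u, of 1 "\<i> * of_real b"], of J t]
    using line J by (simp only: e mem_Collect_eq norm_one simp_thms)
qed

text \<open>\<open>W\<close> has zero Cauchy data on the line: \<open>V\<close> vanishes there, and
  the normal derivatives of \<open>V\<close> and its reflection cancel. Vertical lines that miss the
  disc carry this zero upwards and downwards. Points above or below the disc are reached along
  horizontal lines, on which \<open>W\<close> already vanishes for large abscissae. Since |z| \<le>
  |Re z| + |Im z|, the threshold leaves no third case.\<close>

lemma odd_about_line_far_away:
  fixes V :: "complex \<Rightarrow> complex"
  assumes V: "helmholtz_on \<kappa> D V p q"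
    and R0: "R0 \<ge> 0" "\<And>z. cmod z > R0 \<Longrightarrow> z \<in> D" and line: "\<And>t. Complex t b \<in> D"
    and V0: "\<And>t. V (Complex t b) = 0" and z: "cmod z > 2 * R0 + 2 * \<bar>b\<bar>"
  shows "V z + V (mirror b z) = 0"
proof -
  define D' where "D' = D \<inter> {z. mirror b z \<in> D}"
  define W where "W z = V z + V (mirror b z)" for z
  have "open D'"
    using V helmholtz_on_mirror[OF V, of b] unfolding D'_def helmholtz_on_def by auto
  then have W: "helmholtz_on \<kappa> D' W (\<lambda>z. p z + p (mirror b z)) (\<lambda>z. q z + - q (mirror b z))"
    unfolding W_def D'_def
    by (intro helmholtz_on_add helmholtz_on_subset[OF V] helmholtz_on_subset[OF helmholtz_on_mirror[OF V]]) auto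
  have fixed: "mirror b (Complex t b) = Complex t b" for t by (simp add: complex_eq_iff)
  have far: "w \<in> D'" if "\<bar>Re w\<bar> > R0 \<or> \<bar>Im w\<bar> > R0 + 2 * \<bar>b\<bar>" for w
    using that abs_Re_le_cmod[of w] abs_Re_le_cmod[of "mirror b w"] abs_Im_le_cmod[of w] abs_Im_le_cmod[of "mirror b w"]
    unfolding D'_def by (auto intro!: R0(2))
  have vertical: "W w = 0" if w: "\<bar>Re w\<bar> > R0" for w
  proof -
    let ?a = "Complex (Re w) b"
    have e1: "?a + \<i> * of_real t = Complex (Re w) (b + t)" for t by (simp add: complex_eq_iff)
    have e2: "?a + \<i> * (\<i> * of_real t) = Complex (Re w - t) b" for t by (simp add: complex_eq_iff)
    have "W (?a + \<i> * of_real (Im w - b)) = 0"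
    \<comment> \<open>Rotation by i about the foot point makes the vertical line the real axis and
      the given line the imaginary one; the first partial of the rotated function is then the normal
      derivative.\<close>
    proof (rule helmholtz_real_axis_zero_Cauchy_data[OF helmholtz_on_rigid[OF W, of \<i> ?a]])
      show "of_real t \<in> {z. ?a + \<i> * z \<in> D'}" for t
        using far[of "Complex (Re w) (b + t)"] w by (simp add: e1)
      show "W (?a + \<i> * (\<i> * of_real y)) = 0" for y
        unfolding e2 by (simp add: W_def fixed V0)
      show "Re \<i> *\<^sub>R (p (?a + \<i> * (\<i> * of_real y)) + p (mirror b (?a + \<i> * (\<i> * of_real y))))
          + Im \<i> *\<^sub>R (q (?a + \<i> * (\<i> * of_real y)) + - q (mirror b (?a + \<i> * (\<i> * of_real y)))) = 0" for y
        unfolding e2 fixed by simp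
    qed simp
    then show ?thesis unfolding e1 by (simp add: complex_eq_iff)
  qed
  show ?thesis
  proof (cases "\<bar>Re z\<bar> > R0")
    case True
    then show ?thesis using vertical by (simp add: W_def)
  next
    case False
    then have Im: "\<bar>Im z\<bar> > R0 + 2 * \<bar>b\<bar>" using cmod_le[of z] z by linarith
    have "W (Complex (Re z) (Im z)) = 0"
    proof (rule helmholtz_line_uniqueness[OF W, where J = "{R0<..}"])
      show "Complex t (Im z) \<in> D'" for t using far Im by simp
      show "W (Complex t (Im z)) = 0" if "t \<in> {R0<..}" for t
        using that R0(1) by (intro vertical) auto
    qed auto
    then show ?thesis by (simp add: W_def)
  qed
qed

text \<open>The even part \<open>Q\<close> of \<open>Re u\<close> solves the Helmholtz equation far
  out and each of its modes decays too fast, so \<open>Q\<close> is 0 there. The line is fixed by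
  the reflection, so on it \<open>Q\<close> is 2 \<open>Re u\<close>.\<close>

lemma radiating_determined_by_Im_on_line:
  assumes \<kappa>: "\<kappa> > 0" and u: "helmholtz_on \<kappa> D u p q" and rad: "radiating \<kappa> u p q"
    and R0: "R0 \<ge> 0" "\<And>z. cmod z > R0 \<Longrightarrow> z \<in> D" and line: "\<And>t. Complex t b \<in> D"
    and J: "open J" "J \<noteq> {}" "\<And>t. t \<in> J \<Longrightarrow> Im (u (Complex t b)) = 0"
  shows "u (Complex t b) = 0"
proof -
  \<comment> \<open>The imaginary part is viewed as complex-valued because the uniqueness lemmas,
    resting on holomorphy, are stated for complex functions.\<close>
  define V where "V z = (of_real (Im (u z)) :: complex)" for z
  have "bounded_linear (\<lambda>z. complex_of_real (Im z))"
    by (intro bounded_linear_compose[OF bounded_linear_of_real] bounded_linear_Im)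
  from helmholtz_on_bounded_linear[OF this u]
  have V: "helmholtz_on \<kappa> D V (\<lambda>z. of_real (Im (p z))) (\<lambda>z. of_real (Im (q z)))"
    unfolding V_def .
  have V0: "V (Complex t b) = 0" for t
    by (rule helmholtz_line_uniqueness[OF V line J(1,2)]) (simp add: V_def J(3))
  define R where "R = 2 * R0 + 2 * \<bar>b\<bar>"
  have R: "R \<ge> 0" "R \<ge> R0" "R \<ge> R0 + 2 * \<bar>b\<bar>" using R0(1) by (auto simp: R_def)
  have RD: "z \<in> D" if "cmod z > R" for z using that R R0 by simp
  have odd: "Im (u z) + Im (u (mirror b z)) = 0" if "cmod z > R" for z
  proof -
    have "V z + V (mirror b z) = 0"
      by (rule odd_about_line_far_away[OF V R0 line V0]) (use that in \<open>simp_all add: R_def\<close>)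
    then show ?thesis unfolding V_def by (metis of_real_0 of_real_add of_real_eq_iff)
  qed
  define D' where "D' = D \<inter> {z. mirror b z \<in> D}"
  define Q where "Q z = Re (u z) + Re (u (mirror b z))" for z
  have "open D'"
    using u helmholtz_on_mirror[OF u, of b] unfolding D'_def helmholtz_on_def by auto
  then have Q: "helmholtz_on \<kappa> D' Q (\<lambda>z. Re (p z) + Re (p (mirror b z))) (\<lambda>z. Re (q z) + Re (- q (mirror b z)))"
    unfolding Q_def D'_def
    by (intro helmholtz_on_add helmholtz_on_bounded_linear[OF bounded_linear_Re]
        helmholtz_on_subset[OF u] helmholtz_on_subset[OF helmholtz_on_mirror[OF u]]) auto
  have RD': "z \<in> D'" if "cmod z > R" for z
    using that RD cmod_mirror[of z b] R R0(1) unfolding D'_def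
    by (auto simp: R_def intro!: R0(2))
  have mode: "integral {0..2*pi} (\<lambda>\<phi>. Q (rcis r \<phi>) * e \<phi>) = 0"
    if r: "r > R" and e: "\<And>\<phi>. (e has_real_derivative e' \<phi>) (at \<phi>)"
      "\<And>\<phi>. (e' has_real_derivative - n * e \<phi>) (at \<phi>)"
      and bd: "\<And>\<phi>. \<bar>e \<phi>\<bar> \<le> 1" "\<And>\<phi>. \<bar>e' \<phi>\<bar> \<le> K"
      and per: "e (2 * pi) = e 0" "e' (2 * pi) = e' 0" for r e e' n K
  proof -
    obtain P1 P2 where P:
      "\<And>r. r > R \<Longrightarrow> ((\<lambda>r. integral {0..2*pi} (\<lambda>\<phi>. Q (rcis r \<phi>) * e \<phi>)) has_real_derivative P1 r) (at r)"
      "\<And>r. r > R \<Longrightarrow> (P1 has_real_derivative P2 r) (at r)"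
      "\<And>r. r > R \<Longrightarrow> r\<^sup>2 * P2 r + r * P1 r
        + (\<kappa>\<^sup>2 * r\<^sup>2 - n) * integral {0..2*pi} (\<lambda>\<phi>. Q (rcis r \<phi>) * e \<phi>) = 0"
      using angular_mode_Bessel[OF Q R(1) RD' e per] by blast
    have ug: "has_grad D u p q" using u unfolding helmholtz_on_def by blast
    have lim: "((\<lambda>r. sqrt r * integral {0..2*pi} (\<lambda>\<phi>. Q (rcis r \<phi>) * e \<phi>)) \<longlongrightarrow> 0) at_top"
      unfolding Q_def by (rule even_part_mode_decay[OF \<kappa> rad ug R(1) RD odd e(1) bd per(1)])
    show ?thesis by (rule decaying_Bessel_zero[OF \<kappa> R(1) P lim r])
  qed
  have Q0: "Q z = 0" if z: "cmod z > R" for z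
  proof (rule Fourier_uniqueness[OF _ _ _ _ refl])
    show "continuous_on (sphere 0 (cmod z)) Q"
      by (rule continuous_on_subset[of D'])
        (use Q RD' z in \<open>auto simp: helmholtz_on_def intro: has_grad_continuous_on\<close>)
    show "cmod z > 0" using z R(1) by linarith
    fix k :: int
    \<comment> \<open>The modes cos(k \<phi>) and sin(k \<phi>) have n = k^2 and derivatives bounded
      by |k|; integrality of k gives the period 2 pi.\<close>
    have per: "cos (of_int k * (2 * pi)) = 1" "sin (of_int k * (2 * pi)) = 0"
      using cos_int_2pin[of k] sin_int_2pin[of k] by (simp_all add: mult_ac)
    have kb: "\<bar>of_int k * sin x\<bar> \<le> \<bar>real_of_int k\<bar>" "\<bar>of_int k * cos x\<bar> \<le> \<bar>real_of_int k\<bar>" for x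
      using mult_left_mono[OF abs_sin_le_one[of x], of "\<bar>real_of_int k\<bar>"]
        mult_left_mono[OF abs_cos_le_one[of x], of "\<bar>real_of_int k\<bar>"] by (simp_all add: abs_mult)
    show "integral {0..2*pi} (\<lambda>\<phi>. Q (rcis (cmod z) \<phi>) * cos (of_int k * \<phi>)) = 0"
      by (rule mode[OF z, where e' = "\<lambda>\<phi>. - (of_int k * sin (of_int k * \<phi>))" and n = "(of_int k)\<^sup>2" and K = "\<bar>of_int k\<bar>"])
        (auto intro!: derivative_eq_intros simp: per kb power2_eq_square)
    show "integral {0..2*pi} (\<lambda>\<phi>. Q (rcis (cmod z) \<phi>) * sin (of_int k * \<phi>)) = 0"
      by (rule mode[OF z, where e' = "\<lambda>\<phi>. of_int k * cos (of_int k * \<phi>)" and n = "(of_int k)\<^sup>2" and K = "\<bar>of_int k\<bar>"])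
        (auto intro!: derivative_eq_intros simp: per kb power2_eq_square)
  qed
  show ?thesis
  proof (rule helmholtz_line_uniqueness[OF u line, where J = "{R<..}"])
    fix t assume t: "t \<in> {R<..}"
    have m: "mirror b (Complex t b) = Complex t b" by (simp add: complex_eq_iff)
    have "cmod (Complex t b) > R"
      using abs_Re_le_cmod[of "Complex t b"] t by simp
    from Q0[OF this] have "Re (u (Complex t b)) = 0" unfolding Q_def m by simp
    then show "u (Complex t b) = 0"
      using V0[of t] by (simp add: V_def complex_eq_iff)
  qed auto
qed

section \<open>Transfer to the real plane\<close>

definition plane_vec :: "complex \<Rightarrow> real^2" where
  "plane_vec z = Re z *\<^sub>R axis 1 1 + Im z *\<^sub>R axis 2 1"

lemma plane_vec_nth [simp]: "plane_vec z $ 1 = Re z" "plane_vec z $ 2 = Im z"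
  by (simp_all add: plane_vec_def axis_def)

lemma plane_vec_Complex: "plane_vec (Complex (x $ 1) (x $ 2)) = x"
  by (simp add: vec_eq_iff forall_2)

lemma norm_plane_vec [simp]: "norm (plane_vec z) = cmod z"
  by (simp add: norm_vec_def L2_set_def sum_2 cmod_def)

lemma plane_vec_add: "plane_vec (z + w) = plane_vec z + plane_vec w"
  and plane_vec_scaleR: "plane_vec (c *\<^sub>R z) = c *\<^sub>R plane_vec z"
  by (simp_all add: plane_vec_def algebra_simps)

lemma continuous_on_plane_vec: "continuous_on S plane_vec"
  unfolding plane_vec_def by (intro continuous_intros)

lemma C1_on_has_grad:
  assumes "open U" "C1_on U f"
  shows "has_grad {z. plane_vec z \<in> U} (\<lambda>z. f (plane_vec z))
    (\<lambda>z. partial_deriv 1 f (plane_vec z)) (\<lambda>z. partial_deriv 2 f (plane_vec z))"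
proof (rule has_grad_partials)
  show "open {z. plane_vec z \<in> U}"
    using open_vimage[OF assms(1) continuous_on_plane_vec] by (simp add: vimage_def)
  have d: "((\<lambda>t. f (x + t *\<^sub>R axis i 1)) has_vector_derivative partial_deriv i f x) (at 0)" if "x \<in> U" for x i
    using assms(2) that unfolding C1_on_def partial_deriv_def by (simp add: vector_derivative_works)
  fix z assume z: "z \<in> {z. plane_vec z \<in> U}"
  have "plane_vec (z + of_real t) = plane_vec z + t *\<^sub>R axis 1 1"
    "plane_vec (z + \<i> * of_real t) = plane_vec z + t *\<^sub>R axis 2 1" for t
    by (simp_all add: plane_vec_def algebra_simps)
  then show "((\<lambda>t. f (plane_vec (z + of_real t))) has_vector_derivative partial_deriv 1 f (plane_vec z)) (at 0)"
    "((\<lambda>t. f (plane_vec (z + \<i> * of_real t))) has_vector_derivative partial_deriv 2 f (plane_vec z)) (at 0)"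
    using d[of "plane_vec z"] z by simp_all
next
  show "continuous_on {z. plane_vec z \<in> U} (\<lambda>z. partial_deriv 2 f (plane_vec z))"
    using assms(2) unfolding C1_on_def
    by (intro continuous_on_compose2[OF _ continuous_on_plane_vec]) auto
qed

lemma C2_on_helmholtz_on:
  fixes \<psi> :: "real^2 \<Rightarrow> complex"
  assumes U: "open U" and C2: "C2_on U \<psi>"
    and eq: "\<And>x. x \<in> U \<Longrightarrow> laplacian \<psi> x + of_real (\<kappa>\<^sup>2) * \<psi> x = 0"
  shows "helmholtz_on \<kappa> {z. plane_vec z \<in> U} (\<lambda>z. \<psi> (plane_vec z))
    (\<lambda>z. partial_deriv 1 \<psi> (plane_vec z)) (\<lambda>z. partial_deriv 2 \<psi> (plane_vec z))"
proof -
  have c: "C1_on U \<psi>" "C1_on U (partial_deriv i \<psi>)" for i using C2 unfolding C2_on_def by auto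
  have cont: "continuous_on {z. plane_vec z \<in> U} (\<lambda>z. partial_deriv j (partial_deriv i \<psi>) (plane_vec z))" for i j
    using c(2)[of i] unfolding C1_on_def
    by (intro continuous_on_compose2[OF _ continuous_on_plane_vec]) auto
  show ?thesis
  proof (rule helmholtz_onI[OF _ C1_on_has_grad[OF U c(1)] C1_on_has_grad[OF U c(2)] C1_on_has_grad[OF U c(2)]
        cont cont cont cont])
    show "open {z. plane_vec z \<in> U}"
      using open_vimage[OF U continuous_on_plane_vec] by (simp add: vimage_def)
    show "partial_deriv 1 (partial_deriv 1 \<psi>) (plane_vec z) + partial_deriv 2 (partial_deriv 2 \<psi>) (plane_vec z)
        + \<kappa>\<^sup>2 *\<^sub>R \<psi> (plane_vec z) = 0" if "z \<in> {z. plane_vec z \<in> U}" for z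
      using eq[of "plane_vec z"] that by (simp add: laplacian_def sum_2 scaleR_conv_of_real)
  qed
qed

text \<open>Outside the disc the chain rule applies on every ray, so the
  \<open>vector_derivative\<close> in the radiation condition is a true derivative and equals the
  radial component of the gradient.\<close>

lemma sommerfeld_radiating:
  assumes som: "sommerfeld_radiation \<kappa> \<psi>"
    and u: "has_grad D (\<lambda>z. \<psi> (plane_vec z)) p q"
    and R0: "R0 \<ge> 0" "\<And>z. cmod z > R0 \<Longrightarrow> z \<in> D"
  shows "radiating \<kappa> (\<lambda>z. \<psi> (plane_vec z)) p q"
  unfolding radiating_def
proof (intro allI impI)
  fix \<epsilon> :: real assume "\<epsilon> > 0"
  with som obtain N where N: "\<And>r \<omega>. r \<ge> N \<Longrightarrow> norm \<omega> = 1 \<Longrightarrow>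
     cmod (of_real (sqrt r) * (vector_derivative (\<lambda>s. \<psi> (s *\<^sub>R \<omega>)) (at r) - \<i> * of_real \<kappa> * \<psi> (r *\<^sub>R \<omega>))) < \<epsilon>"
    unfolding sommerfeld_radiation_def uniform_limit_iff eventually_at_top_linorder by fastforce
  have "cmod ((Re z / cmod z) *\<^sub>R p z + (Im z / cmod z) *\<^sub>R q z - \<i> * of_real \<kappa> * \<psi> (plane_vec z)) * sqrt (cmod z) \<le> \<epsilon>"
    if z: "cmod z > max N R0" for z
  proof -
    define r where "r = cmod z"
    define w where "w = (1 / r) *\<^sub>R z"
    have r: "r > 0" "r > R0" "r \<ge> N" using z R0(1) by (auto simp: r_def)
    have rw: "r *\<^sub>R w = z" using r by (simp add: w_def)
    have pz: "r *\<^sub>R plane_vec w = plane_vec z" unfolding plane_vec_scaleR[symmetric] rw ..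
    have "((\<lambda>s. s *\<^sub>R w) has_vector_derivative w) (at r)"
      by (auto intro!: derivative_eq_intros)
    from has_grad_chain[where \<gamma> = "\<lambda>s. s *\<^sub>R w", OF u this, unfolded rw] R0(2)[of z] r
    have "((\<lambda>s. \<psi> (s *\<^sub>R plane_vec w)) has_vector_derivative Re w *\<^sub>R p z + Im w *\<^sub>R q z) (at r)"
      by (simp add: plane_vec_scaleR r_def)
    then have vd: "vector_derivative (\<lambda>s. \<psi> (s *\<^sub>R plane_vec w)) (at r) = Re w *\<^sub>R p z + Im w *\<^sub>R q z"
      by (rule vector_derivative_at)
    have "norm (plane_vec w) = 1" using r by (simp add: w_def r_def)
    from N[OF r(3) this]
    have "cmod (of_real (sqrt r) * (Re w *\<^sub>R p z + Im w *\<^sub>R q z - \<i> * of_real \<kappa> * \<psi> (plane_vec z))) < \<epsilon>"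
      unfolding vd pz .
    then show ?thesis using r by (simp add: norm_mult w_def r_def mult.commute)
  qed
  then show "\<exists>R. \<forall>z. cmod z > R \<longrightarrow>
     cmod ((Re z / cmod z) *\<^sub>R p z + (Im z / cmod z) *\<^sub>R q z - \<i> * of_real \<kappa> * \<psi> (plane_vec z)) * sqrt (cmod z) \<le> \<epsilon>"
    by blast
qed

text \<open>The difference is written as a sum with a negated term to match the shape that
  \<open>helmholtz_on_add\<close> produces.\<close>

lemma radiating_diff:
  assumes "radiating \<kappa> u p q" "radiating \<kappa> v r s"
  shows "radiating \<kappa> (\<lambda>z. u z + - v z) (\<lambda>z. p z + - r z) (\<lambda>z. q z + - s z)"
  unfolding radiating_def
proof (intro allI impI)
  fix \<epsilon> :: real assume "\<epsilon> > 0"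
  then have "\<epsilon> / 2 > 0" by simp
  define du where "du z = (Re z / cmod z) *\<^sub>R p z + (Im z / cmod z) *\<^sub>R q z - \<i> * of_real \<kappa> * u z" for z
  define dv where "dv z = (Re z / cmod z) *\<^sub>R r z + (Im z / cmod z) *\<^sub>R s z - \<i> * of_real \<kappa> * v z" for z
  obtain R1 R2 where R: "\<And>z. cmod z > R1 \<Longrightarrow> cmod (du z) * sqrt (cmod z) \<le> \<epsilon> / 2"
    "\<And>z. cmod z > R2 \<Longrightarrow> cmod (dv z) * sqrt (cmod z) \<le> \<epsilon> / 2"
    using assms \<open>\<epsilon> / 2 > 0\<close> unfolding radiating_def du_def dv_def by meson
  have "cmod (du z - dv z) * sqrt (cmod z) \<le> \<epsilon>" if "cmod z > max R1 R2" for z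
  proof -
    have "cmod (du z - dv z) * sqrt (cmod z) \<le> (cmod (du z) + cmod (dv z)) * sqrt (cmod z)"
      by (intro mult_right_mono norm_triangle_ineq4) simp
    then show ?thesis using R[of z] that by (simp add: distrib_right)
  qed
  moreover have "(Re z / cmod z) *\<^sub>R (p z + - r z) + (Im z / cmod z) *\<^sub>R (q z + - s z) - \<i> * of_real \<kappa> * (u z + - v z)
      = du z - dv z" for z
    by (simp add: du_def dv_def algebra_simps)
  ultimately show "\<exists>R. \<forall>z. cmod z > R \<longrightarrow> cmod ((Re z / cmod z) *\<^sub>R (p z + - r z)
      + (Im z / cmod z) *\<^sub>R (q z + - s z) - \<i> * of_real \<kappa> * (u z + - v z)) * sqrt (cmod z) \<le> \<epsilon>"
    by (intro exI[of _ "max R1 R2"]) simp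
qed

text \<open>A rotation about the origin preserves both |z| and the radial direction, so the defect
  at z is the old defect at the rotated point, without error terms.\<close>

lemma radiating_rotate:
  assumes "radiating \<kappa> u p q" "cmod \<theta> = 1"
  shows "radiating \<kappa> (\<lambda>z. u (\<theta> * z)) (\<lambda>z. Re \<theta> *\<^sub>R p (\<theta> * z) + Im \<theta> *\<^sub>R q (\<theta> * z))
    (\<lambda>z. (- Im \<theta>) *\<^sub>R p (\<theta> * z) + Re \<theta> *\<^sub>R q (\<theta> * z))"
proof -
  have "(Re z / cmod z) *\<^sub>R (Re \<theta> *\<^sub>R p (\<theta> * z) + Im \<theta> *\<^sub>R q (\<theta> * z))
      + (Im z / cmod z) *\<^sub>R ((- Im \<theta>) *\<^sub>R p (\<theta> * z) + Re \<theta> *\<^sub>R q (\<theta> * z))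
      = (Re (\<theta> * z) / cmod (\<theta> * z)) *\<^sub>R p (\<theta> * z) + (Im (\<theta> * z) / cmod (\<theta> * z)) *\<^sub>R q (\<theta> * z)" for z
    using assms(2) by (simp add: norm_mult diff_divide_distrib add_divide_distrib algebra_simps)
  moreover have "cmod (\<theta> * z) = cmod z" for z using assms(2) by (simp add: norm_mult)
  ultimately show ?thesis using assms(1) unfolding radiating_def by metis
qed

section \<open>The exterior region contains the complement of a disc\<close>

lemma closed_regular_curve_bounded:
  assumes "closed_regular_curve S"
  shows "bounded S"
proof -
  from assms obtain g n t where t: "t 0 = 0" "t n = 1" and S: "S = g ` {0..1}"
    and arcs: "\<And>k. k < n \<Longrightarrow> regular_arc_on (t k) (t (Suc k)) g"
    unfolding closed_regular_curve_def by blast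
  have "bounded (g ` {0..t m})" if "m \<le> n" for m
    using that
  proof (induction m)
    case 0
    then show ?case by (simp add: t)
  next
    case (Suc m)
    from Suc.prems have "m < n" by simp
    from arcs[OF this] obtain g' where
      "\<forall>s\<in>{t m..t (Suc m)}. (g has_vector_derivative g' s) (at s within {t m..t (Suc m)})"
      unfolding regular_arc_on_def by blast
    then have "continuous_on {t m..t (Suc m)} g"
      by (meson continuous_on_eq_continuous_within has_vector_derivative_continuous)
    then have "bounded (g ` {t m..t (Suc m)})"
      by (intro compact_imp_bounded compact_continuous_image) auto
    then have "bounded (g ` ({0..t m} \<union> {t m..t (Suc m)}))" using Suc by (simp add: image_Un)
    then show ?case by (rule bounded_subset) (intro image_mono, auto)
  qed
  from this[of n] show ?thesis by (simp add: S t)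
qed

lemma exterior_region_cobounded:
  assumes "exterior_region U"
  obtains R where "R \<ge> 0" "\<And>x. norm x > R \<Longrightarrow> x \<in> U"
proof -
  from assms obtain S where "closed_regular_curve S" "U = outside S"
    unfolding exterior_region_def by blast
  then have "bounded (- U)" using cobounded_outside closed_regular_curve_bounded by blast
  then obtain R where "\<And>x. x \<in> - U \<Longrightarrow> norm x \<le> R" unfolding bounded_iff by blast
  then show thesis using that[of "max R 0"] by fastforce
qed

theorem theorem2:
  fixes \<kappa> :: real
    and U L \<Lambda> :: "(real^2) set"
    and x\<^sub>0 \<theta> :: "real^2"
    and \<psi>\<^sub>1 \<psi>\<^sub>2 :: "real^2 \<Rightarrow> complex"
  assumes "\<kappa> > 0"
    and "exterior_region U"
    and "\<theta> \<in> sphere 0 1"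
    and "L = straight_line x\<^sub>0 \<theta>"
    and "L \<subseteq> U"
    and "nonempty_open_interval_of_line x\<^sub>0 \<theta> \<Lambda>"
    and "radiation_solution \<kappa> U \<psi>\<^sub>1"
    and "radiation_solution \<kappa> U \<psi>\<^sub>2"
    and "\<forall>x\<in>\<Lambda>. Im (\<psi>\<^sub>1 x) = Im (\<psi>\<^sub>2 x)"
  shows "\<forall>x\<in>L. \<psi>\<^sub>1 x = \<psi>\<^sub>2 x"
proof -
  have U: "open U" using assms(2) by (simp add: exterior_region_def)
  obtain R where R: "R \<ge> 0" "\<And>x. norm x > R \<Longrightarrow> x \<in> U"
    using exterior_region_cobounded[OF assms(2)] by blast
  let ?D = "{z. plane_vec z \<in> U}"
  have RD: "z \<in> ?D" if "cmod z > R" for z using R(2)[of "plane_vec z"] that by simp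
  have sol: "helmholtz_on \<kappa> ?D (\<lambda>z. \<psi> (plane_vec z)) (\<lambda>z. partial_deriv 1 \<psi> (plane_vec z)) (\<lambda>z. partial_deriv 2 \<psi> (plane_vec z))"
    "radiating \<kappa> (\<lambda>z. \<psi> (plane_vec z)) (\<lambda>z. partial_deriv 1 \<psi> (plane_vec z)) (\<lambda>z. partial_deriv 2 \<psi> (plane_vec z))"
    if "radiation_solution \<kappa> U \<psi>" for \<psi>
  proof -
    show *: "helmholtz_on \<kappa> ?D (\<lambda>z. \<psi> (plane_vec z)) (\<lambda>z. partial_deriv 1 \<psi> (plane_vec z)) (\<lambda>z. partial_deriv 2 \<psi> (plane_vec z))"
      using that unfolding radiation_solution_def by (intro C2_on_helmholtz_on[OF U]) auto
    show "radiating \<kappa> (\<lambda>z. \<psi> (plane_vec z)) (\<lambda>z. partial_deriv 1 \<psi> (plane_vec z)) (\<lambda>z. partial_deriv 2 \<psi> (plane_vec z))"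
      using that * R(1) RD unfolding radiation_solution_def helmholtz_on_def
      by (intro sommerfeld_radiating) auto
  qed
  note hd = helmholtz_on_add[OF sol(1)[OF assms(7)]
      helmholtz_on_bounded_linear[OF bounded_linear_minus[OF bounded_linear_ident] sol(1)[OF assms(8)]]]
  note rd = radiating_diff[OF sol(2)[OF assms(7)] sol(2)[OF assms(8)]]
  \<comment> \<open>Multiplication by \<open>c\<close> turns the horizontal direction into \<theta>,
    and \<open>w\<close> is the preimage of the base point. Hence the line becomes Im z = Im w, and
    its parameter s corresponds to the abscissa Re w + s.\<close>
  define c where "c = Complex (\<theta> $ 1) (\<theta> $ 2)"
  define w where "w = cnj c * Complex (x\<^sub>0 $ 1) (x\<^sub>0 $ 2)"
  have c1: "cmod c = 1" using assms(3) norm_plane_vec[of c] by (simp add: c_def plane_vec_Complex)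
  have point: "plane_vec (0 + c * Complex (Re w + s) (Im w)) = x\<^sub>0 + s *\<^sub>R \<theta>" for s
  proof -
    have "c * cnj c = 1" using c1 by (simp add: complex_norm_square[symmetric] power2_eq_square)
    then have "c * w = Complex (x\<^sub>0 $ 1) (x\<^sub>0 $ 2)"
      unfolding w_def by (metis mult.assoc mult_1)
    moreover have "Complex (Re w + s) (Im w) = w + of_real s" by (simp add: complex_eq_iff)
    ultimately have "0 + c * Complex (Re w + s) (Im w) = Complex (x\<^sub>0 $ 1) (x\<^sub>0 $ 2) + s *\<^sub>R c"
      by (simp add: distrib_left scaleR_conv_of_real mult.commute)
    then show ?thesis by (simp add: plane_vec_add plane_vec_scaleR plane_vec_Complex c_def)
  qed
  have on_line: "x\<^sub>0 + s *\<^sub>R \<theta> \<in> U" for s using assms(4,5) by (auto simp: straight_line_def)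
  obtain J where J: "open J" "J \<noteq> {}" "\<Lambda> = {x\<^sub>0 + s *\<^sub>R \<theta> | s. s \<in> J}"
    using assms(6) unfolding nonempty_open_interval_of_line_def by blast
  have "\<psi>\<^sub>1 (x\<^sub>0 + s *\<^sub>R \<theta>) = \<psi>\<^sub>2 (x\<^sub>0 + s *\<^sub>R \<theta>)" for s
  proof -
    have pt: "plane_vec (0 + c * Complex t (Im w)) = x\<^sub>0 + (t - Re w) *\<^sub>R \<theta>" for t
      using point[of "t - Re w"] by simp
    have "\<psi>\<^sub>1 (plane_vec (0 + c * Complex (Re w + s) (Im w))) + - \<psi>\<^sub>2 (plane_vec (0 + c * Complex (Re w + s) (Im w))) = 0"
    proof (rule radiating_determined_by_Im_on_line[OF assms(1) helmholtz_on_rigid[OF hd c1, of 0] _ R(1)])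
      show "radiating \<kappa> (\<lambda>z. \<psi>\<^sub>1 (plane_vec (0 + c * z)) + - \<psi>\<^sub>2 (plane_vec (0 + c * z)))
         (\<lambda>z. Re c *\<^sub>R (partial_deriv 1 \<psi>\<^sub>1 (plane_vec (0 + c * z)) + - partial_deriv 1 \<psi>\<^sub>2 (plane_vec (0 + c * z)))
            + Im c *\<^sub>R (partial_deriv 2 \<psi>\<^sub>1 (plane_vec (0 + c * z)) + - partial_deriv 2 \<psi>\<^sub>2 (plane_vec (0 + c * z))))
         (\<lambda>z. (- Im c) *\<^sub>R (partial_deriv 1 \<psi>\<^sub>1 (plane_vec (0 + c * z)) + - partial_deriv 1 \<psi>\<^sub>2 (plane_vec (0 + c * z)))
            + Re c *\<^sub>R (partial_deriv 2 \<psi>\<^sub>1 (plane_vec (0 + c * z)) + - partial_deriv 2 \<psi>\<^sub>2 (plane_vec (0 + c * z))))"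
        using radiating_rotate[OF rd c1] by (simp only: add_0_left)
      show "z \<in> {z. 0 + c * z \<in> ?D}" if "cmod z > R" for z
        using RD[of "c * z"] that c1 by (simp add: norm_mult)
      show "Complex t (Im w) \<in> {z. 0 + c * z \<in> ?D}" for t
        using on_line pt by simp
      show "open ((\<lambda>s. Re w + s) ` J)" using J(1) by (rule open_translation)
      show "(\<lambda>s. Re w + s) ` J \<noteq> {}" using J(2) by simp
      fix t assume "t \<in> (\<lambda>s. Re w + s) ` J"
      then have "x\<^sub>0 + (t - Re w) *\<^sub>R \<theta> \<in> \<Lambda>" using J(3) by auto
      then show "Im (\<psi>\<^sub>1 (plane_vec (0 + c * Complex t (Im w))) + - \<psi>\<^sub>2 (plane_vec (0 + c * Complex t (Im w)))) = 0"
        unfolding pt using assms(9) by simp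
    qed
    then show ?thesis unfolding point by simp
  qed
  then show ?thesis using assms(4) by (auto simp: straight_line_def)
qed

end
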